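(* Fix a constant $p_{\infty,*}>0$. Assume the radiation condition for the liquid temperature: $$T_l(|x|)=T_\infty+o(|x|^{-1}),\quad |x|\to\infty .$$ Then there is a smooth map from values of the bubble mass to equilibrium radii, $M\in(0,\infty)\mapsto R_*[M]$, such that any regular (non-singular) spherically symmetric equilibrium solution of (FS) (for fixed parameters) of bubble mass $M$ is expressible as $$\mathbf v_{l,*}=\mathbf 0,\qquad p_{l,*}=p_{\infty,*},\qquad \Omega_*=B_{R_*[M]},$$ $$\rho_{g,*}[M]=\frac1{\mathcal R_gT_\infty}\Big(p_{\infty,*}+\frac{2\sigma}{R_*[M]}\Big),\qquad \mathbf v_{g,*}=\mathbf 0,\qquad p_{g,*}[M]=p_{\infty,*}+\frac{2\sigma}{R_*[M]},$$ $$T_{g,*}=T_{l,*}=T_\infty,\qquad s_*=c_v\log\Big((\mathcal R_gT_\infty)^\gamma\Big(p_{\infty,*}+\frac{2\sigma}{R_*[M]}\Big)^{1-\gamma}\Big).$$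
   Context: Parameters: $\rho_l,c_l,\kappa_l,\mu_g,\zeta_g,\kappa_g,\mathcal R_g,c_v,\sigma,T_\infty>0$, $\mu_l\ge0$, $\gamma=1+\mathcal R_g/c_v>1$. $\mathbb D(\mathbf u)=\frac12(\nabla\mathbf u+(\nabla\mathbf u)^\top)$, $A:B=\sum_{i,j}A_{ij}B_{ij}$, $B_R=\{x\in\mathbb R^3:|x|<R\}$. (FS) is the following free boundary system for a gas bubble occupying a bounded simply connected region $\Omega(t)\subset\mathbb R^3$ in a liquid. Liquid, in $\mathbb R^3\setminus\Omega(t)$: $\partial_t(\rho_l\mathbf v_l)+\mathrm{div}(\rho_l\mathbf v_l\otimes\mathbf v_l)=\mathrm{div}\,\mathbb T_l$, $\mathrm{div}\,\mathbf v_l=0$, $\rho_lc_l(\partial_tT_l+\mathbf v_l\cdot\nabla T_l)=\mathrm{div}(\kappa_l\nabla T_l)+\mathbb S_l:\nabla\mathbf v_l$, with $\mathbb S_l=2\mu_l\mathbb D(\mathbf v_l)$ and $\mathbb T_l=-p_l\mathbb I+\mathbb S_l$. Gas, in $\Omega(t)$: $\partial_t\rho_g+\mathrm{div}(\rho_g\mathbf v_g)=0$, $\partial_t(\rho_g\mathbf v_g)+\mathrm{div}(\rho_g\mathbf v_g\otimes\mathbf v_g)=\mathrm{div}\,\mathbb T_g$, $\rho_gT_g(\partial_ts+\mathbf v_g\cdot\nabla s)=\mathrm{div}(\kappa_g\nabla T_g)+\mathbb S_g:\nabla\mathbf v_g$, $p_g=\mathcal R_gT_g\rho_g$, $s=c_v\log(p_g/\rho_g^\gamma)$,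 with $\mathbb S_g=2\mu_g(\mathbb D(\mathbf v_g)-\frac13(\mathrm{div}\,\mathbf v_g)\mathbb I)+\zeta_g(\mathrm{div}\,\mathbf v_g)\mathbb I$ and $\mathbb T_g=-p_g\mathbb I+\mathbb S_g$. Interface $\partial\Omega(t)$, with outer unit normal $\hat{\mathbf n}$ and parametrization $\boldsymbol\omega$: $\mathbf v_l\cdot\hat{\mathbf n}=\mathbf v_g\cdot\hat{\mathbf n}=\partial_t\boldsymbol\omega\cdot\hat{\mathbf n}$, $\hat{\mathbf n}\cdot\mathbb T_l-\hat{\mathbf n}\cdot\mathbb T_g=\sigma\hat{\mathbf n}(\nabla_S\cdot\hat{\mathbf n})$, $T_g=T_l$, where $\nabla_S\cdot$ is the surface divergence. Far field: $\mathbf v_l\to\mathbf 0$, $p_l\to p_{\infty,*}$, $T_l\to T_\infty$ as $|x|\to\infty$. An equilibrium solution is a time-independent solution (so the interface normal velocity is $0$). Spherically symmetric means: $\Omega$ is a ball centered at the origin, $\mathbf v_l,\mathbf v_g$ have the form $v(r)\,x/|x|$, $r=|x|$, and all scalar fields are radial. The bubble mass is $\int_{\Omega}\rho_g\,dx$. *)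

theory Defs
  imports "HOL-Analysis.Analysis" "HOL-Library.Landau_Symbols"
begin

section \<open>Differential operators on three-space\<close>

text \<open>All operators use the full derivative \<^term>\<open>at x\<close>; they are only applied at points of
  open sets on which the argument is required to be differentiable.\<close>

type_synonym R3 = "real ^ 3"
type_synonym tensor = "real ^ 3 ^ 3"

definition gradient :: "(R3 \<Rightarrow> real) \<Rightarrow> R3 \<Rightarrow> R3" where
  "gradient f x = (\<chi> i. frechet_derivative f (at x) (axis i 1))"

definition divergence :: "(R3 \<Rightarrow> R3) \<Rightarrow> R3 \<Rightarrow> real" where
  "divergence u x = trace (jacobian u (at x))"

text \<open>Row-wise: $(\mathrm{div} A)_i = \sum_j \partial_j A_{ij}$.\<close>

definition tensor_div :: "(R3 \<Rightarrow> tensor) \<Rightarrow> R3 \<Rightarrow> R3" where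
  "tensor_div A x = (\<chi> i. divergence (\<lambda>y. A y $ i) x)"

definition outer_prod :: "R3 \<Rightarrow> R3 \<Rightarrow> tensor" where
  "outer_prod u w = (\<chi> i j. u $ i * w $ j)"

definition deformation :: "(R3 \<Rightarrow> R3) \<Rightarrow> R3 \<Rightarrow> tensor" where
  "deformation u x = (1 / 2) *\<^sub>R (jacobian u (at x) + transpose (jacobian u (at x)))"

definition C1_on :: "R3 set \<Rightarrow> (R3 \<Rightarrow> 'b::real_normed_vector) \<Rightarrow> bool" where
  "C1_on U f \<longleftrightarrow> (\<forall>x\<in>U. f differentiable (at x)) \<and>
     (\<forall>h. continuous_on U (\<lambda>x. frechet_derivative f (at x) h))"

definition C2_on :: "R3 set \<Rightarrow> (R3 \<Rightarrow> 'b::real_normed_vector) \<Rightarrow> bool" where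
  "C2_on U f \<longleftrightarrow> C1_on U f \<and> (\<forall>h. C1_on U (\<lambda>x. frechet_derivative f (at x) h))"

definition time_deriv :: "(real \<Rightarrow> 'b::real_normed_vector) \<Rightarrow> real \<Rightarrow> 'b" where
  "time_deriv f t = vector_derivative f (at t)"

definition smooth_on_open :: "real set \<Rightarrow> (real \<Rightarrow> real) \<Rightarrow> bool" where
  "smooth_on_open U f \<longleftrightarrow> open U \<and> (\<forall>k. ((deriv ^^ k) f) differentiable_on U)"


section \<open>Surfaces\<close>

text \<open>\<open>n\<close> is the outer unit normal at \<open>x\<close> of a domain whose boundary is \<open>C\<^sup>1\<close> near \<open>x\<close>,
  expressed through a local defining function that is negative inside.\<close>

definition outer_unit_normal :: "R3 set \<Rightarrow> R3 \<Rightarrow> R3 \<Rightarrow> bool" where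
  "outer_unit_normal D x n \<longleftrightarrow> x \<in> frontier D \<and>
     (\<exists>U \<phi>. open U \<and> x \<in> U \<and> C1_on U \<phi> \<and> (\<forall>y\<in>U. gradient \<phi> y \<noteq> 0) \<and>
        D \<inter> U = {y \<in> U. \<phi> y < 0} \<and> frontier D \<inter> U = {y \<in> U. \<phi> y = 0} \<and>
        n = gradient \<phi> x /\<^sub>R norm (gradient \<phi> x))"

text \<open>Surface divergence on \<open>S\<close> with unit normal field \<open>n\<close>: the trace of the derivative along
  \<open>S\<close> composed with the tangential projection, $\sum_{i,j}(\delta_{ij}-n_in_j)\partial_jF_i$.
  A derivative within \<open>S\<close> is determined on tangent vectors only, and only these enter.\<close>

definition surface_div :: "R3 set \<Rightarrow> (R3 \<Rightarrow> R3) \<Rightarrow> (R3 \<Rightarrow> R3) \<Rightarrow> R3 \<Rightarrow> real" where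
  "surface_div S n F x =
     trace (matrix (\<lambda>h. frechet_derivative F (at x within S) (h - (h \<bullet> n x) *\<^sub>R n x)))"


section \<open>Parameters and states\<close>

record bubble_params =
  rho_l :: real
  c_l :: real
  kappa_l :: real
  mu_l :: real
  mu_g :: real
  zeta_g :: real
  kappa_g :: real
  gas_const :: real  \<comment> \<open>$\mathcal R_g$\<close>
  c_v :: real
  surf_tension :: real
  T_inf :: real

definition gamma_exp :: "bubble_params \<Rightarrow> real" where
  "gamma_exp P = 1 + gas_const P / c_v P"

definition positive_params :: "bubble_params \<Rightarrow> bool" where
  "positive_params P \<longleftrightarrow> rho_l P > 0 \<and> c_l P > 0 \<and> kappa_l P > 0 \<and> mu_l P \<ge> 0 \<and>
     mu_g P > 0 \<and> zeta_g P > 0 \<and> kappa_g P > 0 \<and> gas_const P > 0 \<and> c_v P > 0 \<and>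
     surf_tension P > 0 \<and> T_inf P > 0"

text \<open>A state at one instant. The fields are total functions; the values of the liquid fields
  inside the bubble, of the gas fields outside its closure, of \<open>surf_param\<close> off the unit sphere
  and of \<open>surf_normal\<close> off the interface carry no meaning.\<close>

record bubble_state =
  bubble :: "R3 set"
  v_liq :: "R3 \<Rightarrow> R3"
  p_liq :: "R3 \<Rightarrow> real"
  T_liq :: "R3 \<Rightarrow> real"
  rho_gas :: "R3 \<Rightarrow> real"
  v_gas :: "R3 \<Rightarrow> R3"
  p_gas :: "R3 \<Rightarrow> real"
  T_gas :: "R3 \<Rightarrow> real"
  s_gas :: "R3 \<Rightarrow> real"
  surf_param :: "R3 \<Rightarrow> R3"  \<comment> \<open>$\omega$, defined on the unit sphere\<close>
  surf_normal :: "R3 \<Rightarrow> R3"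

abbreviation interface :: "bubble_state \<Rightarrow> R3 set" where
  "interface S \<equiv> frontier (bubble S)"

abbreviation liquid :: "bubble_state \<Rightarrow> R3 set" where
  "liquid S \<equiv> - closure (bubble S)"

definition visc_liq :: "bubble_params \<Rightarrow> bubble_state \<Rightarrow> R3 \<Rightarrow> tensor" where
  "visc_liq P S x = (2 * mu_l P) *\<^sub>R deformation (v_liq S) x"

definition stress_liq :: "bubble_params \<Rightarrow> bubble_state \<Rightarrow> R3 \<Rightarrow> tensor" where
  "stress_liq P S x = - (p_liq S x *\<^sub>R mat 1) + visc_liq P S x"

definition visc_gas :: "bubble_params \<Rightarrow> bubble_state \<Rightarrow> R3 \<Rightarrow> tensor" where
  "visc_gas P S x =
     (2 * mu_g P) *\<^sub>R (deformation (v_gas S) x - ((1 / 3) * divergence (v_gas S) x) *\<^sub>R mat 1)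
     + (zeta_g P * divergence (v_gas S) x) *\<^sub>R mat 1"

definition stress_gas :: "bubble_params \<Rightarrow> bubble_state \<Rightarrow> R3 \<Rightarrow> tensor" where
  "stress_gas P S x = - (p_gas S x *\<^sub>R mat 1) + visc_gas P S x"


section \<open>The free boundary system\<close>

text \<open>Evolutions are curves \<open>Z\<close> of states. The double contraction \<open>A : B\<close> is the inner product
  on matrices.\<close>

definition liquid_eqs :: "bubble_params \<Rightarrow> (real \<Rightarrow> bubble_state) \<Rightarrow> real \<Rightarrow> bool" where
  "liquid_eqs P Z t \<longleftrightarrow> (let S = Z t in \<forall>x \<in> liquid S.
     (\<lambda>\<tau>. v_liq (Z \<tau>) x) differentiable (at t) \<and>
     (\<lambda>\<tau>. T_liq (Z \<tau>) x) differentiable (at t) \<and>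
     time_deriv (\<lambda>\<tau>. rho_l P *\<^sub>R v_liq (Z \<tau>) x) t
       + tensor_div (\<lambda>y. rho_l P *\<^sub>R outer_prod (v_liq S y) (v_liq S y)) x
       = tensor_div (stress_liq P S) x \<and>
     divergence (v_liq S) x = 0 \<and>
     rho_l P * c_l P * (time_deriv (\<lambda>\<tau>. T_liq (Z \<tau>) x) t + v_liq S x \<bullet> gradient (T_liq S) x)
       = divergence (\<lambda>y. kappa_l P *\<^sub>R gradient (T_liq S) y) x
         + visc_liq P S x \<bullet> jacobian (v_liq S) (at x))"

text \<open>Positivity of density and temperature is implicit in the use of the logarithm.\<close>

definition gas_eqs :: "bubble_params \<Rightarrow> (real \<Rightarrow> bubble_state) \<Rightarrow> real \<Rightarrow> bool" where
  "gas_eqs P Z t \<longleftrightarrow> (let S = Z t in \<forall>x \<in> bubble S.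
     (\<lambda>\<tau>. rho_gas (Z \<tau>) x) differentiable (at t) \<and>
     (\<lambda>\<tau>. v_gas (Z \<tau>) x) differentiable (at t) \<and>
     (\<lambda>\<tau>. s_gas (Z \<tau>) x) differentiable (at t) \<and>
     rho_gas S x > 0 \<and> T_gas S x > 0 \<and>
     time_deriv (\<lambda>\<tau>. rho_gas (Z \<tau>) x) t + divergence (\<lambda>y. rho_gas S y *\<^sub>R v_gas S y) x = 0 \<and>
     time_deriv (\<lambda>\<tau>. rho_gas (Z \<tau>) x *\<^sub>R v_gas (Z \<tau>) x) t
       + tensor_div (\<lambda>y. rho_gas S y *\<^sub>R outer_prod (v_gas S y) (v_gas S y)) x
       = tensor_div (stress_gas P S) x \<and>
     rho_gas S x * T_gas S x
         * (time_deriv (\<lambda>\<tau>. s_gas (Z \<tau>) x) t + v_gas S x \<bullet> gradient (s_gas S) x)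
       = divergence (\<lambda>y. kappa_g P *\<^sub>R gradient (T_gas S) y) x
         + visc_gas P S x \<bullet> jacobian (v_gas S) (at x) \<and>
     p_gas S x = gas_const P * T_gas S x * rho_gas S x \<and>
     s_gas S x = c_v P * ln (p_gas S x / rho_gas S x powr gamma_exp P))"

definition bubble_geometry :: "bubble_state \<Rightarrow> bool" where
  "bubble_geometry S \<longleftrightarrow>
     open (bubble S) \<and> bubble S \<noteq> {} \<and> bounded (bubble S) \<and> simply_connected (bubble S) \<and>
     (\<exists>g. homeomorphism (sphere 0 1) (interface S) (surf_param S) g) \<and>
     (\<forall>x \<in> interface S. outer_unit_normal (bubble S) x (surf_normal S x)) \<and>
     surf_normal S differentiable_on interface S"

text \<open>The stresses at the interface are the one-sided boundary values.\<close>

definition interface_eqs :: "bubble_params \<Rightarrow> (real \<Rightarrow> bubble_state) \<Rightarrow> real \<Rightarrow> bool" where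
  "interface_eqs P Z t \<longleftrightarrow> (let S = Z t; n = surf_normal S in
     (\<forall>\<alpha> \<in> sphere 0 1. let x = surf_param S \<alpha> in
        (\<lambda>\<tau>. surf_param (Z \<tau>) \<alpha>) differentiable (at t) \<and>
        v_liq S x \<bullet> n x = time_deriv (\<lambda>\<tau>. surf_param (Z \<tau>) \<alpha>) t \<bullet> n x \<and>
        v_gas S x \<bullet> n x = time_deriv (\<lambda>\<tau>. surf_param (Z \<tau>) \<alpha>) t \<bullet> n x) \<and>
     (\<forall>x \<in> interface S. \<exists>A B.
        (stress_liq P S \<longlongrightarrow> A) (at x within liquid S) \<and>
        (stress_gas P S \<longlongrightarrow> B) (at x within bubble S) \<and>
        n x v* A - n x v* B = (surf_tension P * surface_div (interface S) n n x) *\<^sub>R n x) \<and>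
     (\<forall>x \<in> interface S. T_gas S x = T_liq S x))"

definition far_field :: "bubble_params \<Rightarrow> real \<Rightarrow> bubble_state \<Rightarrow> bool" where
  "far_field P p_infty S \<longleftrightarrow>
     (v_liq S \<longlongrightarrow> 0) at_infinity \<and> (p_liq S \<longlongrightarrow> p_infty) at_infinity \<and>
     (T_liq S \<longlongrightarrow> T_inf P) at_infinity"

definition fs_solution ::
    "bubble_params \<Rightarrow> real \<Rightarrow> real set \<Rightarrow> (real \<Rightarrow> bubble_state) \<Rightarrow> bool" where
  "fs_solution P p_infty J Z \<longleftrightarrow> (\<forall>t\<in>J. bubble_geometry (Z t) \<and> liquid_eqs P Z t \<and>
     gas_eqs P Z t \<and> interface_eqs P Z t \<and> far_field P p_infty (Z t))"


section \<open>Spherically symmetric equilibria\<close>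

text \<open>The system is of second order in velocities and temperatures and of first order in the
  remaining fields; regularity is that of a classical solution, continuous up to the interface.
  In particular the gas fields are non-singular at the centre of the bubble.\<close>

definition regular_state :: "bubble_state \<Rightarrow> bool" where
  "regular_state S \<longleftrightarrow>
     C2_on (liquid S) (v_liq S) \<and> C1_on (liquid S) (p_liq S) \<and> C2_on (liquid S) (T_liq S) \<and>
     C1_on (bubble S) (rho_gas S) \<and> C2_on (bubble S) (v_gas S) \<and> C1_on (bubble S) (p_gas S) \<and>
     C2_on (bubble S) (T_gas S) \<and> C1_on (bubble S) (s_gas S) \<and>
     continuous_on (- bubble S) (v_liq S) \<and> continuous_on (- bubble S) (p_liq S) \<and>
     continuous_on (- bubble S) (T_liq S) \<and>
     continuous_on (closure (bubble S)) (rho_gas S) \<and>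
     continuous_on (closure (bubble S)) (v_gas S) \<and>
     continuous_on (closure (bubble S)) (p_gas S) \<and>
     continuous_on (closure (bubble S)) (T_gas S) \<and>
     continuous_on (closure (bubble S)) (s_gas S)"

definition fs_equilibrium :: "bubble_params \<Rightarrow> real \<Rightarrow> bubble_state \<Rightarrow> bool" where
  "fs_equilibrium P p_infty S \<longleftrightarrow> fs_solution P p_infty UNIV (\<lambda>t. S)"

definition radial_on :: "R3 set \<Rightarrow> (R3 \<Rightarrow> real) \<Rightarrow> bool" where
  "radial_on D f \<longleftrightarrow> (\<exists>g. \<forall>x\<in>D. f x = g (norm x))"

definition radial_vec_on :: "R3 set \<Rightarrow> (R3 \<Rightarrow> R3) \<Rightarrow> bool" where
  "radial_vec_on D u \<longleftrightarrow> (\<exists>g. \<forall>x\<in>D - {0}. u x = g (norm x) *\<^sub>R (x /\<^sub>R norm x))"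

definition spherically_symmetric :: "bubble_state \<Rightarrow> bool" where
  "spherically_symmetric S \<longleftrightarrow>
     (\<exists>R>0. bubble S = ball 0 R) \<and>
     radial_vec_on (- bubble S) (v_liq S) \<and> radial_vec_on (closure (bubble S)) (v_gas S) \<and>
     radial_on (- bubble S) (p_liq S) \<and> radial_on (- bubble S) (T_liq S) \<and>
     radial_on (closure (bubble S)) (rho_gas S) \<and> radial_on (closure (bubble S)) (p_gas S) \<and>
     radial_on (closure (bubble S)) (T_gas S) \<and> radial_on (closure (bubble S)) (s_gas S)"

definition radiation_condition :: "bubble_params \<Rightarrow> bubble_state \<Rightarrow> bool" where
  "radiation_condition P S \<longleftrightarrow>
     (\<lambda>x. T_liq S x - T_inf P) \<in> o[at_infinity](\<lambda>x. inverse (norm x))"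

definition bubble_mass :: "bubble_state \<Rightarrow> real" where
  "bubble_mass S = integral (bubble S) (rho_gas S)"

text \<open>The regular spherically symmetric equilibria of bubble mass \<open>M\<close> that satisfy the radiation
  condition for the liquid temperature.\<close>

definition symmetric_equilibria :: "bubble_params \<Rightarrow> real \<Rightarrow> real \<Rightarrow> bubble_state set" where
  "symmetric_equilibria P p_infty M =
     {S. fs_equilibrium P p_infty S \<and> regular_state S \<and> spherically_symmetric S \<and>
         radiation_condition P S \<and> bubble_mass S = M}"

end

theory Submission
  imports Defs
begin

text \<open>A radial solenoidal field has the form $g(r)\,x/r$ with $r^2g(r)$ constant. Applied to the
  liquid velocity, to the gas momentum and to both temperature gradients, this leaves one constant
  each. The constant vanishes for the liquid velocity by impermeability of the interface, for the
  liquid temperature by the radiation condition, and for the gas fields by regularity at the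
  centre. The momentum equations then make both pressures constant, the stress balance
  fixes their jump to be $2\sigma/R$, and the bubble mass becomes a cubic polynomial in $R$ with
  positive coefficients, which is a diffeomorphism of $(0,\infty)$.\<close>

section \<open>Radial fields\<close>

text \<open>Symmetry only provides some profile of the norm, with no regularity of its own. Each
  profile therefore inherits its derivative from the field by restriction to a ray, and tangential
  derivatives are computed along curves on the sphere. The same device serves the interface, where
  the outer normal comes from an arbitrary defining function and a derivative within the sphere is
  undetermined in the normal direction. The velocities have to vanish first: only then do the
  momentum equations reduce to a vanishing pressure gradient and the heat equations to Laplace's
  equation. The differential equations hold in the open phases and the polar form degenerates at the
  origin, so values at the interface and at the centre come from continuity. An equilibrium is also
  constructed for every mass. Hence the description is not vacuous and the radius function is
  determined on the positive axis.\<close>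

lemma has_derivative_zero_tangent:
  fixes f :: "R3 \<Rightarrow> 'b::real_normed_vector"
  assumes D: "(f has_derivative D) (at x within S)"
    and S: "S = sphere 0 (norm x) \<inter> U" "open U" "x \<in> U"
    and const: "\<And>y. y \<in> S \<Longrightarrow> f y = f x"
    and tangent: "v \<bullet> x = 0" and "x \<noteq> 0"
  shows "D v = 0"
proof (cases "v = 0")
  case True
  then show ?thesis using D has_derivative_bounded_linear linear_0 bounded_linear.linear by blast
next
  case False
  \<comment> \<open>Rescaling \<open>v\<close> to the length of \<open>x\<close> makes
    \<open>c\<close> a great circle through \<open>x\<close> with velocity \<open>w\<close>. Near
    time 0 it stays in \<open>S\<close>, where \<open>f\<close> is constant, so the chain rule gives
    \<open>D w = 0\<close>.\<close>
  define w where "w = (norm x / norm v) *\<^sub>R v"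
  define c where "c t = cos t *\<^sub>R x + sin t *\<^sub>R w" for t :: real
  have w: "w \<bullet> x = 0" "x \<bullet> w = 0" "w \<bullet> w = x \<bullet> x"
    using tangent False by (auto simp: w_def inner_commute power2_norm_eq_inner[symmetric] power_divide field_simps
      simp flip: power2_eq_square)
  have nc: "norm (c t) = norm x" for t
  proof -
    have "c t \<bullet> c t = (cos t)\<^sup>2 * (x \<bullet> x) + (sin t)\<^sup>2 * (w \<bullet> w)"
      unfolding c_def by (simp add: inner_add w(1,2) power2_eq_square)
    also have "\<dots> = x \<bullet> x"
      by (simp add: w(3) flip: distrib_right)
    finally have "c t \<bullet> c t = x \<bullet> x" .
    then show ?thesis by (simp add: norm_eq_sqrt_inner)
  qed
  have c0: "c 0 = x" by (simp add: c_def)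
  have cd: "(c has_derivative (\<lambda>h. h *\<^sub>R w)) (at 0)"
    unfolding c_def by (auto intro!: derivative_eq_intros)
  have contc: "continuous_on UNIV c" unfolding c_def by (intro continuous_intros)
  define V where "V = c -` U"
  have V: "open V" "0 \<in> V" 
    using contc S(2,3) c0 by (auto simp: V_def intro: open_vimage)
  have cV: "c ` V \<subseteq> S" using nc S(1) by (auto simp: V_def)
  have "((f \<circ> c) has_derivative (D \<circ> (\<lambda>h. h *\<^sub>R w))) (at 0 within V)"
    by (rule diff_chain_within[OF has_derivative_at_withinI[OF cd]])
       (use D cV c0 has_derivative_subset in auto)
  then have "((f \<circ> c) has_derivative (D \<circ> (\<lambda>h. h *\<^sub>R w))) (at 0)"
    by (simp only: at_within_open[OF V(2,1)])
  then have "((\<lambda>t. f x) has_derivative (D \<circ> (\<lambda>h. h *\<^sub>R w))) (at 0)"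
    by (rule has_derivative_transform_within_open[OF _ V]) (use const cV in auto)
  then have "(D \<circ> (\<lambda>h. h *\<^sub>R w)) = (\<lambda>h. 0)"
    using has_derivative_unique has_derivative_const by blast
  then have "D w = 0" by (auto simp: fun_eq_iff dest: spec[of _ 1])
  moreover have "D w = (norm x / norm v) *\<^sub>R D v"
    unfolding w_def using D has_derivative_bounded_linear linear_scale bounded_linear.linear by blast
  ultimately show ?thesis using False \<open>x \<noteq> 0\<close> by simp
qed

section \<open>Gradient and divergence in coordinates\<close>

lemma frechet_derivative_eqI:
  "(f has_derivative D) (at x) \<Longrightarrow> frechet_derivative f (at x) = D"
  using frechet_derivative_at by metis

lemma frechet_derivative_cong_open:
  assumes "open U" "x \<in> U" "\<And>y. y \<in> U \<Longrightarrow> f y = g y"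
  shows "frechet_derivative f (at x) = frechet_derivative g (at x)"
proof -
  have "(f has_derivative D) (at x) \<longleftrightarrow> (g has_derivative D) (at x)" for D
    using assms by (metis has_derivative_transform_within_open)
  then show ?thesis by (simp add: frechet_derivative_def)
qed

lemma divergence_cong_open:
  assumes "open U" "x \<in> U" "\<And>y. y \<in> U \<Longrightarrow> f y = g y"
  shows "divergence f x = divergence g x"
  unfolding divergence_def jacobian_def using frechet_derivative_cong_open[OF assms] by simp

lemma divergence_eq_sum:
  assumes "(u has_derivative D) (at x)"
  shows "divergence u x = (\<Sum>i\<in>UNIV. D (axis i 1) $ i)"
  using frechet_derivative_eqI[OF assms]
  by (simp add: divergence_def jacobian_def trace_def matrix_def)

lemma divergence_const [simp]: "divergence (\<lambda>y. c) x = 0"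
  by (simp add: divergence_eq_sum[OF has_derivative_const])

lemma has_derivative_gradient:
  assumes "f differentiable (at x)"
  shows "(f has_derivative (\<lambda>h. gradient f x \<bullet> h)) (at x)"
proof -
  have *: "(f has_derivative frechet_derivative f (at x)) (at x)"
    using assms frechet_derivative_works by blast
  let ?D = "frechet_derivative f (at x)"
  have lin: "linear ?D" using * has_derivative_linear by blast
  have "?D = (\<lambda>h. gradient f x \<bullet> h)"
  proof
    fix h
    have "?D h = ?D (\<Sum>i\<in>UNIV. h $ i *\<^sub>R axis i 1)"
      by (simp add: basis_expansion flip: scalar_mult_eq_scaleR)
    also have "\<dots> = (\<Sum>i\<in>UNIV. h $ i * ?D (axis i 1))"
      by (simp add: linear_sum[OF lin] linear_scale[OF lin])
    finally show "?D h = gradient f x \<bullet> h" by (simp add: gradient_def inner_vec_def mult.commute)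
  qed
  with * show ?thesis by simp
qed

lemma gradient_const [simp]: "gradient (\<lambda>y. c) x = 0"
  by (simp add: gradient_def frechet_derivative_eqI[OF has_derivative_const] vec_eq_iff)

text \<open>The form of \<open>A\<close> is asked only on an open neighbourhood, because the viscous
  part of a stress is known to vanish only inside its own phase.\<close>

lemma tensor_div_pressure:
  assumes "open U" "x \<in> U" "\<And>y. y \<in> U \<Longrightarrow> A y = - (p y *\<^sub>R mat 1)" "p differentiable (at x)"
  shows "tensor_div A x = - gradient p x"
proof -
  have "divergence (\<lambda>y. A y $ i) x = - gradient p x $ i" for i
  proof -
    have "divergence (\<lambda>y. A y $ i) x = divergence (\<lambda>y. - (p y *\<^sub>R axis i 1)) x"
      by (rule divergence_cong_open[OF assms(1,2)])
         (simp add: assms(3) vec_eq_iff mat_def axis_def)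
    also have "\<dots> = (\<Sum>j\<in>UNIV. (- ((gradient p x \<bullet> axis j 1) *\<^sub>R axis i 1)) $ j)"
      by (rule divergence_eq_sum) (auto intro!: derivative_eq_intros has_derivative_gradient assms(4))
    also have "\<dots> = - gradient p x $ i"
      by (simp add: inner_axis sum_negf, simp add: axis_def if_distrib[of "\<lambda>z. _ * z"] cong: if_cong)
    finally show ?thesis .
  qed
  then show ?thesis by (simp add: tensor_div_def vec_eq_iff)
qed

text \<open>The profile \<open>g\<close> carries no regularity assumption; its derivative is read
  off \<open>u\<close> along the first axis. In the trace the radial direction contributes g', and
  each of the two tangential directions contributes g/r.\<close>

lemma radial_field_derivative:
  assumes I: "open I" "r \<in> I" "r > 0"
    and u: "\<And>x. norm x \<in> I \<Longrightarrow> u x = g (norm x) *\<^sub>R (x /\<^sub>R norm x)"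
    and d: "u differentiable (at (r *\<^sub>R axis 1 1))"
  shows "(g has_real_derivative divergence u (r *\<^sub>R axis 1 1) - 2 * g r / r) (at r)"
proof -
  let ?e = "axis 1 1 :: R3"
  obtain D where D: "(u has_derivative D) (at (r *\<^sub>R ?e))"
    using d unfolding differentiable_def by blast
  have "((\<lambda>s. u (s *\<^sub>R ?e)) has_derivative (\<lambda>h. D (h *\<^sub>R ?e))) (at r)"
    by (rule has_derivative_compose[where g=u]) (use D in \<open>auto intro!: derivative_eq_intros\<close>)
  then have "((\<lambda>s. u (s *\<^sub>R ?e) \<bullet> ?e) has_derivative (\<lambda>h. D (h *\<^sub>R ?e) \<bullet> ?e)) (at r)"
    by (rule has_derivative_inner_left)
  then have "(g has_derivative (\<lambda>h. D (h *\<^sub>R ?e) \<bullet> ?e)) (at r)"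
    by (rule has_derivative_transform_within_open[where s = "I \<inter> {0<..}"])
       (use I in \<open>auto simp: u norm_axis_1 inner_axis_axis\<close>)
  moreover have lin: "linear D" using D has_derivative_linear by blast
  ultimately have 1: "(g has_real_derivative D ?e $ 1) (at r)"
    by (simp add: has_field_derivative_def linear_scale inner_axis mult_commute_abs)
  have 2: "D (axis j 1) = (g r / r) *\<^sub>R axis j 1" if "j \<noteq> 1" for j
  proof -
    \<comment> \<open>On the sphere of radius \<open>r\<close> the field agrees with a linear map.
      The difference of the two vanishes there, hence so does its tangential derivative.\<close>
    have lin_on_sphere: "u y = (g r / r) *\<^sub>R y" if "norm y = r" for y
      using I that by (simp add: u divide_inverse)
    have "D (axis j 1) - (g r / r) *\<^sub>R axis j 1 = 0"
    proof (rule has_derivative_zero_tangent[where D = "\<lambda>h. D h - (g r / r) *\<^sub>R h" and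
        f = "\<lambda>y. u y - (g r / r) *\<^sub>R y" and S = "sphere 0 r" and U = UNIV and x = "r *\<^sub>R ?e"])
      show "((\<lambda>y. u y - (g r / r) *\<^sub>R y) has_derivative (\<lambda>h. D h - (g r / r) *\<^sub>R h))
          (at (r *\<^sub>R ?e) within sphere 0 r)"
        by (rule has_derivative_at_withinI) (auto intro!: derivative_eq_intros D)
      show "axis j 1 \<bullet> (r *\<^sub>R ?e) = 0" using that by (simp add: inner_axis_axis)
    qed (use I in \<open>auto simp: lin_on_sphere\<close>)
    then show ?thesis by simp
  qed
  have "D (axis j 1) $ j = g r / r" if "j \<noteq> 1" for j
    unfolding 2[OF that] by simp
  from this[of 2] this[of 3] have "divergence u (r *\<^sub>R ?e) - 2 * g r / r = D ?e $ 1"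
    unfolding divergence_eq_sum[OF D] sum_3 by simp
  with 1 show ?thesis by (simp only:)
qed

text \<open>Up to the factor 4 pi, r^2 g(r) is the flux through the sphere of radius r. Zero
  divergence means g' = -2g/r, which makes the derivative of this product zero; convexity of
  \<open>I\<close> leaves a single constant.\<close>

lemma radial_solenoidal:
  assumes I: "open I" "convex I" "I \<subseteq> {0<..}"
    and u: "\<And>x. norm x \<in> I \<Longrightarrow> u x = g (norm x) *\<^sub>R (x /\<^sub>R norm x)"
    and d: "\<And>x. norm x \<in> I \<Longrightarrow> u differentiable (at x)"
    and div: "\<And>x. norm x \<in> I \<Longrightarrow> divergence u x = 0"
  obtains c where "\<And>r. r \<in> I \<Longrightarrow> r\<^sup>2 * g r = c"
proof -
  have "((\<lambda>r. r\<^sup>2 * g r) has_real_derivative 0) (at r within I)" if r: "r \<in> I" for r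
  proof -
    have "r > 0" using r I by auto
    have "(g has_real_derivative - 2 * g r / r) (at r)"
      using radial_field_derivative[OF I(1) r \<open>r > 0\<close> u d] r \<open>r > 0\<close> 
      by (simp add: norm_axis_1 div)
    then have "((\<lambda>r. r\<^sup>2 * g r) has_real_derivative 0) (at r)"
      using \<open>r > 0\<close> by (auto intro!: derivative_eq_intros simp: power2_eq_square)
    then show ?thesis by (rule has_field_derivative_at_within)
  qed
  from has_field_derivative_zero_constant[OF I(2) this] show ?thesis using that by blast
qed

text \<open>Testing with the part of \<open>G\<close> orthogonal to \<open>e\<close> shows that this
  part has norm zero.\<close>

lemma eq_scaleR_if_orthogonal:
  fixes G e :: "'a::real_inner"
  assumes "norm e = 1" and "\<And>v. v \<bullet> e = 0 \<Longrightarrow> G \<bullet> v = 0"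
  shows "G = (G \<bullet> e) *\<^sub>R e"
proof -
  define w where "w = G - (G \<bullet> e) *\<^sub>R e"
  have "e \<bullet> e = 1" using assms(1) by (simp add: dot_square_norm)
  then have "w \<bullet> e = 0" by (simp add: w_def inner_diff_left)
  moreover from this have "G \<bullet> w = 0" by (rule assms(2))
  moreover have "w \<bullet> w = G \<bullet> w - (G \<bullet> e) * (w \<bullet> e)"
    unfolding w_def by (simp add: inner_diff_left inner_commute)
  ultimately have "w = 0" by simp
  then show ?thesis by (simp add: w_def)
qed

text \<open>Here too the profile is arbitrary: it is differentiable because \<open>f\<close> is so
  along the ray through \<open>x\<close>. Tangential directions contribute nothing, since
  \<open>f\<close> is constant on the sphere through \<open>x\<close>.\<close>

lemma radial_gradient:
  assumes I: "open I" "norm x \<in> I" "x \<noteq> 0"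
    and f: "\<And>x. norm x \<in> I \<Longrightarrow> f x = h (norm x)"
    and d: "f differentiable (at x)"
  shows "(h has_real_derivative deriv h (norm x)) (at (norm x))"
    and "gradient f x = deriv h (norm x) *\<^sub>R (x /\<^sub>R norm x)"
proof -
  let ?e = "x /\<^sub>R norm x" and ?r = "norm x"
  note D = has_derivative_gradient[OF d]
  have ray: "f (s *\<^sub>R ?e) = h s" if "s \<in> I" "s > 0" for s
  proof -
    have "norm (s *\<^sub>R ?e) = s" using that I(3) by (simp only: norm_scaleR) simp
    then show ?thesis using f[of "s *\<^sub>R ?e"] that(1) by (simp only:)
  qed
  have "((\<lambda>s. f (s *\<^sub>R ?e)) has_derivative (\<lambda>h. gradient f x \<bullet> (h *\<^sub>R ?e))) (at ?r)"
    by (rule has_derivative_compose[where g=f]) (use I D in \<open>auto intro!: derivative_eq_intros\<close>)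
  then have "(h has_derivative (\<lambda>h. gradient f x \<bullet> (h *\<^sub>R ?e))) (at ?r)"
    by (rule has_derivative_transform_within_open[where s = "I \<inter> {0<..}"])
       (use I ray in auto)
  then have 1: "(h has_real_derivative gradient f x \<bullet> ?e) (at ?r)"
    by (simp only: has_field_derivative_def inner_scaleR_right mult_commute_abs)
  then have 2: "deriv h ?r = gradient f x \<bullet> ?e" by (rule DERIV_imp_deriv)
  with 1 show "(h has_real_derivative deriv h ?r) (at ?r)" by simp
  show "gradient f x = deriv h ?r *\<^sub>R ?e"
    unfolding 2
  proof (rule eq_scaleR_if_orthogonal)
    show "norm ?e = 1" using I(3) by simp
    show "gradient f x \<bullet> v = 0" if "v \<bullet> ?e = 0" for v
      by (rule has_derivative_zero_tangent[OF has_derivative_at_withinI[OF D, of "sphere 0 ?r"], of UNIV])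
        (use I that f in auto)
  qed
qed

lemma tensor_div_cong_open:
  assumes "open U" "x \<in> U" "\<And>y. y \<in> U \<Longrightarrow> A y = B y"
  shows "tensor_div A x = tensor_div B x"
proof -
  have "divergence (\<lambda>y. A y $ i) x = divergence (\<lambda>y. B y $ i) x" for i
    by (rule divergence_cong_open[OF assms(1,2)]) (simp only: assms(3))
  then show ?thesis by (simp only: tensor_div_def)
qed

lemma tensor_div_const [simp]: "tensor_div (\<lambda>y. A) x = 0"
  by (simp add: tensor_div_def vec_eq_iff)

lemma jacobian_zero_on_open:
  assumes "open U" "x \<in> U" "\<And>y. y \<in> U \<Longrightarrow> f y = (0 :: R3)"
  shows "jacobian f (at x) = 0"
  using frechet_derivative_cong_open[OF assms] frechet_derivative_eqI[OF has_derivative_const, of 0 x]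
  by (simp add: jacobian_def matrix_def vec_eq_iff)

lemma deformation_eq_0: "jacobian u (at x) = 0 \<Longrightarrow> deformation u x = 0"
  by (simp add: deformation_def transpose_def vec_eq_iff)

lemma divergence_eq_0: "jacobian u (at x) = 0 \<Longrightarrow> divergence u x = 0"
  by (simp add: divergence_def trace_def)

section \<open>Passing to the centre and to the boundary of the ball\<close>

lemma unit_direction:
  fixes x :: R3
  obtains e where "norm e = 1" "x = norm x *\<^sub>R e"
proof (cases "x = 0")
  case True
  then show ?thesis using that[of "axis 1 1"] by (simp add: norm_axis_1)
next
  case False
  then show ?thesis using that[of "x /\<^sub>R norm x"] by simp
qed

text \<open>Along a ray through \<open>x\<close> the value on (0,R) extends by continuity to [0,R],
  which settles the centre and the boundary sphere together. For \<open>x = 0\<close> any ray will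
  do.\<close>

lemma constant_on_cball_if_punctured:
  fixes f :: "R3 \<Rightarrow> 'b::t1_space"
  assumes cont: "continuous_on (cball 0 R) f" and "R > 0"
    and const: "\<And>x. norm x \<in> {0<..<R} \<Longrightarrow> f x = a"
    and x: "x \<in> cball 0 R"
  shows "f x = a"
proof -
  obtain e where e: "norm e = 1" "x = norm x *\<^sub>R e" by (rule unit_direction)
  have "continuous_on {0..R} (\<lambda>r. f (r *\<^sub>R e))"
    by (rule continuous_on_compose2[OF cont]) (use e in \<open>auto intro!: continuous_intros\<close>)
  moreover have "f (r *\<^sub>R e) = a" if "r \<in> {0<..<R}" for r
    using that e(1) by (intro const) simp
  moreover have "closure {0<..<R} = {0..R}" using \<open>R > 0\<close> by simp
  moreover have "norm x \<in> {0..R}" using x by simp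
  ultimately have "f (norm x *\<^sub>R e) = a"
    using continuous_constant_on_closure[of "{0<..<R}" "\<lambda>r. f (r *\<^sub>R e)" a "norm x"] by metis
  then show ?thesis using e(2) by simp
qed

text \<open>Continuity bounds the field near the centre, so r^2 times its component along
  \<open>e\<close> tends to 0, and a constant must equal its limit.\<close>

lemma central_flux_zero:
  fixes u :: "R3 \<Rightarrow> R3"
  assumes u: "isCont u 0" and "R > 0"
    and c: "\<And>r. r \<in> {0<..<R} \<Longrightarrow> r\<^sup>2 * (u (r *\<^sub>R e) \<bullet> e) = c"
  shows "c = 0"
proof -
  have "((\<lambda>r. r *\<^sub>R e) \<longlongrightarrow> 0) (at_right (0::real))"
    by (auto intro!: tendsto_eq_intros)
  then have "((\<lambda>r. u (r *\<^sub>R e)) \<longlongrightarrow> u 0) (at_right 0)"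
    by (rule isCont_tendsto_compose[OF u])
  then have "((\<lambda>r. r\<^sup>2 * (u (r *\<^sub>R e) \<bullet> e)) \<longlongrightarrow> 0\<^sup>2 * (u 0 \<bullet> e)) (at_right 0)"
    by (intro tendsto_intros)
  moreover have "eventually (\<lambda>r. r\<^sup>2 * (u (r *\<^sub>R e) \<bullet> e) = c) (at_right 0)"
    using eventually_at_right_real[OF \<open>R > 0\<close>] by eventually_elim (rule c)
  ultimately have "((\<lambda>r. c) \<longlongrightarrow> 0\<^sup>2 * (u 0 \<bullet> e)) (at_right (0::real))"
    by (rule Lim_transform_eventually)
  then show ?thesis by (simp add: tendsto_const_iff)
qed

section \<open>Integrating radial gradients\<close>

lemma radial_gradient_zero:
  assumes I: "open I" "convex I" "I \<subseteq> {0<..}"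
    and f: "\<And>x. norm x \<in> I \<Longrightarrow> f x = h (norm x)"
    and d: "\<And>x. norm x \<in> I \<Longrightarrow> f differentiable (at x)"
    and grad: "\<And>x. norm x \<in> I \<Longrightarrow> gradient f x = 0"
  obtains c where "\<And>x. norm x \<in> I \<Longrightarrow> f x = c"
proof -
  have "(h has_real_derivative 0) (at r within I)" if r: "r \<in> I" for r
  proof -
    define x :: R3 where "x = r *\<^sub>R axis 1 1"
    have x: "norm x = r" "x \<noteq> 0" "norm x \<in> I"
      using r I by (auto simp: x_def norm_axis_1)
    have "deriv h r = 0"
      using radial_gradient(2)[OF I(1) x(3,2) f d[OF x(3)]] grad[OF x(3)] x by auto
    then show ?thesis
      using radial_gradient(1)[OF I(1) x(3,2) f d[OF x(3)]] x(1) by (simp add: has_field_derivative_at_within)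
  qed
  from has_field_derivative_zero_constant[OF I(2) this] obtain c where "\<And>r. r \<in> I \<Longrightarrow> h r = c" by blast
  then show ?thesis using that f by auto
qed

lemma C2_on_gradient:
  assumes "C2_on U f" "x \<in> U"
  shows "gradient f differentiable (at x)"
proof -
  have "(\<lambda>y. frechet_derivative f (at y) (axis i 1)) differentiable (at x)" for i
    using assms by (simp add: C2_on_def C1_on_def)
  moreover have "gradient f = (\<lambda>y. \<Sum>i\<in>UNIV. frechet_derivative f (at y) (axis i 1) *\<^sub>R axis i 1)"
    by (rule ext) (simp add: gradient_def vec_eq_iff axis_def if_distrib[of "\<lambda>z. _ * z"] cong: if_cong)
  ultimately show ?thesis
    by (auto intro!: differentiable_sum differentiable_scaleR)
qed

text \<open>The heat flux, up to sign \<open>k *\<^sub>R gradient f\<close>, is solenoidal, which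
  leaves an inverse-square gradient. The profile form is meant for integration, the vector form for
  the limit at the centre.\<close>

lemma radial_harmonic:
  assumes I: "open I" "convex I" "I \<subseteq> {0<..}" and k: "k > 0"
    and f: "\<And>x. norm x \<in> I \<Longrightarrow> f x = h (norm x)"
    and C2: "C2_on U f" "\<And>x. norm x \<in> I \<Longrightarrow> x \<in> U"
    and harm: "\<And>x. norm x \<in> I \<Longrightarrow> divergence (\<lambda>y. k *\<^sub>R gradient f y) x = 0"
  obtains c where "\<And>r. r \<in> I \<Longrightarrow> (h has_real_derivative c / r\<^sup>2) (at r)"
    "\<And>x. norm x \<in> I \<Longrightarrow> gradient f x = (c / (norm x)\<^sup>2) *\<^sub>R (x /\<^sub>R norm x)"
proof -
  have d: "f differentiable (at x)" if "norm x \<in> I" for x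
    using C2 that by (simp add: C2_on_def C1_on_def)
  have nz: "x \<noteq> 0" if "norm x \<in> I" for x :: R3 using that I(3) by auto
  note G = radial_gradient[OF I(1) _ nz f d]
  obtain c where c: "\<And>r. r \<in> I \<Longrightarrow> r\<^sup>2 * (k * deriv h r) = c"
  proof (rule radial_solenoidal[OF I, of "\<lambda>y. k *\<^sub>R gradient f y" "\<lambda>r. k * deriv h r"])
    show "k *\<^sub>R gradient f x = (k * deriv h (norm x)) *\<^sub>R (x /\<^sub>R norm x)" if "norm x \<in> I" for x
      using G(2)[of x] that by simp
    show "(\<lambda>y. k *\<^sub>R gradient f y) differentiable (at x)" if "norm x \<in> I" for x
      using C2_on_gradient[OF C2] that by (intro differentiable_scaleR) auto
  qed (use harm in auto)
  have dh: "deriv h r = (c / k) / r\<^sup>2" if "r \<in> I" for r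
  proof -
    have "r > 0" using I(3) that by auto
    then show ?thesis using c[OF that] k by (simp add: field_simps)
  qed
  show ?thesis
  proof (rule that[of "c / k"])
    show "(h has_real_derivative c / k / r\<^sup>2) (at r)" if r: "r \<in> I" for r
    proof -
      have n: "norm (r *\<^sub>R axis 1 1 :: R3) = r" using r I(3) by (auto simp: norm_axis_1)
      show ?thesis using G(1)[of "r *\<^sub>R axis 1 1"] r dh[OF r] unfolding n by simp
    qed
    show "gradient f x = (c / k / (norm x)\<^sup>2) *\<^sub>R (x /\<^sub>R norm x)" if "norm x \<in> I" for x
      using G(2)[of x] that dh[OF that] by simp
  qed
qed

lemma ray_at_infinity:
  fixes e :: R3
  assumes "norm e = 1"
  shows "filterlim (\<lambda>r. r *\<^sub>R e) at_infinity at_top"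
proof -
  have "filterlim (\<lambda>r::real. norm (r *\<^sub>R e)) at_top at_top"
    using assms filterlim_abs_real by simp
  then show ?thesis by (rule filterlim_norm_at_top_imp_at_infinity)
qed

lemma exterior_radial_harmonic:
  assumes R: "R \<ge> 0" and k: "k > 0"
    and f: "\<And>x. norm x \<in> {R<..} \<Longrightarrow> f x = h (norm x)"
    and C2: "C2_on U f" "\<And>x. norm x \<in> {R<..} \<Longrightarrow> x \<in> U"
    and harm: "\<And>x. norm x \<in> {R<..} \<Longrightarrow> divergence (\<lambda>y. k *\<^sub>R gradient f y) x = 0"
    and lim: "(f \<longlongrightarrow> T) at_infinity"
    and rad: "(\<lambda>x. f x - T) \<in> o[at_infinity](\<lambda>x. inverse (norm x))"
    and x: "norm x > R"
  shows "f x = T"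
proof -
  define e :: R3 where "e = axis 1 1"
  have e: "norm e = 1" by (simp add: e_def norm_axis_1)
  obtain c where c: "\<And>r. r \<in> {R<..} \<Longrightarrow> (h has_real_derivative c / r\<^sup>2) (at r)"
    by (rule radial_harmonic[of "{R<..}" k f h U]) (use assms in auto)
  \<comment> \<open>Integrating the slope \<open>c / r\<^sup>2\<close> gives a constant minus
    \<open>c / r\<close>, that is, the Newtonian potential up to constants.\<close>
  have "((\<lambda>r. h r + c / r) has_real_derivative 0) (at r within {R<..})" if "r \<in> {R<..}" for r
  proof -
    have "r \<noteq> 0" using that R by auto
    then have "((\<lambda>r. h r + c / r) has_real_derivative 0) (at r)"
      by (auto intro!: derivative_eq_intros c[OF that] simp: power2_eq_square)
    then show ?thesis by (rule has_field_derivative_at_within)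
  qed
  from has_field_derivative_zero_constant[OF _ this] obtain a where
    a: "\<And>r. r > R \<Longrightarrow> h r = a - c / r" by (force simp: algebra_simps)
  have ray: "f (r *\<^sub>R e) = a - c / r" if "r > R" for r
    using f[of "r *\<^sub>R e"] a[OF that] e that R by simp
  have ev: "eventually (\<lambda>r. r > R) at_top" by (rule eventually_gt_at_top)
  have "((\<lambda>r. f (r *\<^sub>R e)) \<longlongrightarrow> T) at_top"
    by (rule filterlim_compose[OF lim ray_at_infinity[OF e]])
  moreover have "eventually (\<lambda>r. f (r *\<^sub>R e) = a - c / r) at_top"
    using ev by eventually_elim (rule ray)
  ultimately have "((\<lambda>r. a - c / r) \<longlongrightarrow> T) at_top" by (rule Lim_transform_eventually)
  moreover have "((\<lambda>r. a - c / r) \<longlongrightarrow> a - 0) at_top"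
    by (intro tendsto_diff tendsto_const
        tendsto_divide_0[OF tendsto_const filterlim_at_top_imp_at_infinity[OF filterlim_ident]])
  ultimately have aT: "a = T" using tendsto_unique trivial_limit_at_top_linorder by fastforce
  \<comment> \<open>Once \<open>a = T\<close>, the deviation from \<open>T\<close> along the ray has
    size exactly |c|/r. Smallness with the factor |c|/2 would give |c|/r \<le> |c|/(2r).\<close>
  have "c = 0"
  proof (rule ccontr)
    assume "c \<noteq> 0"
    then have "eventually (\<lambda>x. norm (f x - T) \<le> \<bar>c\<bar> / 2 * norm (inverse (norm x))) at_infinity"
      using landau_o.smallD[OF rad, of "\<bar>c\<bar> / 2"] by simp
    then have "eventually (\<lambda>r. norm (f (r *\<^sub>R e) - T) \<le> \<bar>c\<bar> / 2 * norm (inverse (norm (r *\<^sub>R e)))) at_top"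
      using ray_at_infinity[OF e] by (rule eventually_compose_filterlim)
    with ev have "eventually (\<lambda>r. False) (at_top :: real filter)"
    proof eventually_elim
      case (elim r)
      have r: "r > 0" using elim(1) R by simp
      have "norm (f (r *\<^sub>R e) - T) = \<bar>c\<bar> / r"
        using ray[OF elim(1)] r by (simp only: aT) simp
      moreover have "norm (inverse (norm (r *\<^sub>R e))) = 1 / r"
        using e r by (simp add: inverse_eq_divide)
      ultimately have "\<bar>c\<bar> / r \<le> \<bar>c\<bar> / 2 * (1 / r)" using elim(2) by (simp only:)
      then have "\<bar>c\<bar> / r * r \<le> \<bar>c\<bar> / 2 * (1 / r) * r" using r by (intro mult_right_mono) simp_all
      then have "\<bar>c\<bar> \<le> \<bar>c\<bar> / 2" using r by simp
      then show False using \<open>c \<noteq> 0\<close> by simp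
    qed
    then show False by simp
  qed
  then show ?thesis using f[of x] a[OF x] x by (simp add: aT)
qed

section \<open>Geometry of the sphere\<close>

text \<open>The defining function is arbitrary, so only its zero set and its sign can be used:
  vanishing on the sphere makes the gradient radial, and negativity inside makes it point
  outwards.\<close>

lemma outer_unit_normal_ball:
  assumes "outer_unit_normal (ball 0 R) x n"
  shows "n = x /\<^sub>R R"
proof -
  obtain U \<phi> where U: "open U" "x \<in> U" "C1_on U \<phi>" "gradient \<phi> x \<noteq> 0"
      "ball 0 R \<inter> U = {y \<in> U. \<phi> y < 0}" "frontier (ball 0 R) \<inter> U = {y \<in> U. \<phi> y = 0}"
      "n = gradient \<phi> x /\<^sub>R norm (gradient \<phi> x)" and x: "x \<in> frontier (ball 0 R)"
    using assms unfolding outer_unit_normal_def by blast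
  have R: "R > 0" 
    using x by (metis frontier_empty ball_empty empty_iff not_less)
  have nx: "norm x = R" "x \<noteq> 0" using x R by auto
  let ?G = "gradient \<phi> x"
  define e where "e = x /\<^sub>R R"
  have xe: "x = R *\<^sub>R e" using R by (simp add: e_def)
  have d: "\<phi> differentiable (at x)" using U by (simp add: C1_on_def)
  note D = has_derivative_gradient[OF d]
  have zero: "\<phi> y = 0" if "y \<in> sphere 0 R \<inter> U" for y
    using that U(6) frontier_ball[OF R, of "0::R3"] by blast
  have ne: "norm e = 1" using nx R by (simp add: e_def)
  define k where "k = ?G \<bullet> e"
  have G: "?G = k *\<^sub>R e"
    unfolding k_def
  proof (rule eq_scaleR_if_orthogonal[OF ne])
    show "?G \<bullet> v = 0" if "v \<bullet> e = 0" for v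
      by (rule has_derivative_zero_tangent[OF has_derivative_at_withinI[OF D, of "sphere 0 R \<inter> U"], of U])
        (use U(1,2) nx zero that R in \<open>auto simp: e_def\<close>)
  qed
  \<comment> \<open>With a negative radial slope, moving inwards from \<open>x\<close> would raise
    the function above its value 0 at \<open>x\<close>, although it is negative inside the
    ball.\<close>
  have "?G \<bullet> e \<ge> 0"
  proof (rule ccontr)
    assume neg: "\<not> ?G \<bullet> e \<ge> 0"
    have "((\<lambda>s. \<phi> (s *\<^sub>R e)) has_derivative (\<lambda>h. ?G \<bullet> (h *\<^sub>R e))) (at R)"
      by (rule has_derivative_compose[where g=\<phi>]) (use D xe in \<open>auto intro!: derivative_eq_intros\<close>)
    then have "((\<lambda>s. \<phi> (s *\<^sub>R e)) has_real_derivative ?G \<bullet> e) (at R)"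
      by (simp only: has_field_derivative_def inner_scaleR_right mult_commute_abs)
    from has_real_derivative_neg_dec_left[OF this] neg obtain d where
      d: "d > 0" "\<And>h. 0 < h \<Longrightarrow> h < d \<Longrightarrow> \<phi> (R *\<^sub>R e) < \<phi> ((R - h) *\<^sub>R e)" by auto
    have "((\<lambda>s. s *\<^sub>R e) \<longlongrightarrow> R *\<^sub>R e) (at_left R)" by (intro tendsto_intros)
    then have "eventually (\<lambda>s. s *\<^sub>R e \<in> U) (at_left R)"
      using topological_tendstoD[of _ _ _ U] U(1,2) xe by auto
    moreover have "eventually (\<lambda>s. s \<in> {max 0 (R - d)<..<R}) (at_left R)"
      using R d by (intro eventually_at_left_real) auto
    ultimately have "eventually (\<lambda>s. s *\<^sub>R e \<in> U \<and> s \<in> {max 0 (R - d)<..<R}) (at_left R)"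
      by eventually_elim simp
    then obtain s where s: "s *\<^sub>R e \<in> U" "0 < s" "R - d < s" "s < R"
      using eventually_happens' trivial_limit_at_left_real by fastforce
    have "norm (s *\<^sub>R e) < R" using s ne by simp
    then have "s *\<^sub>R e \<in> ball 0 R \<inter> U" using s(1) by simp
    then have "\<phi> (s *\<^sub>R e) < 0" unfolding U(5) by simp
    moreover have "\<phi> x = 0" using zero nx U by auto
    ultimately show False using d(2)[of "R - s"] s xe by simp
  qed
  then have "k \<ge> 0" by (simp only: k_def)
  moreover have "k \<noteq> 0" using G U(4) by auto
  ultimately have k: "k > 0" by simp
  have "n = (k *\<^sub>R e) /\<^sub>R norm (k *\<^sub>R e)" using U(7) by (simp only: G)
  also have "norm (k *\<^sub>R e) = k" using ne k by simp
  finally show ?thesis using k by (simp add: e_def)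
qed

text \<open>The squared norm minus \<open>R\<^sup>2\<close> serves as defining function; the origin
  is removed from the neighbourhood because the gradient \<open>2 *\<^sub>R y\<close> vanishes
  there.\<close>

lemma outer_unit_normal_ball_self:
  assumes R: "R > 0" and x: "x \<in> sphere 0 R"
  shows "outer_unit_normal (ball 0 R) x (x /\<^sub>R R)"
proof -
  let ?\<phi> = "\<lambda>y::R3. y \<bullet> y - R\<^sup>2"
  have D: "(?\<phi> has_derivative (\<lambda>h. 2 * (y \<bullet> h))) (at y)" for y
    by (auto intro!: derivative_eq_intros simp: inner_commute)
  have g: "gradient ?\<phi> y = 2 *\<^sub>R y" for y
    by (simp add: gradient_def frechet_derivative_eqI[OF D] vec_eq_iff inner_axis)
  have "C1_on (- {0}) ?\<phi>" unfolding C1_on_def frechet_derivative_eqI[OF D]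
    using D by (auto intro!: continuous_intros simp: differentiable_def)
  moreover have "ball 0 R = {y. ?\<phi> y < 0}"
    using R by (auto simp: norm_lt_square)
  moreover have "frontier (ball 0 R) = {y. ?\<phi> y = 0}"
    using R by (auto simp: norm_eq_square)
  moreover have "x /\<^sub>R R = (2 *\<^sub>R x) /\<^sub>R norm (2 *\<^sub>R x)" "x \<noteq> 0" "x \<in> frontier (ball 0 R)"
    using R x by auto
  ultimately show ?thesis unfolding outer_unit_normal_def
    by (intro conjI exI[of _ "- {0}"] exI[of _ ?\<phi>]) (simp_all only: g, auto)
qed

text \<open>Within the sphere \<open>frechet_derivative\<close> picks some derivative, uncontrolled
  in the normal direction. The projection feeds it tangent vectors only, on which it is division by
  \<open>R\<close>, and the tangential projection has trace 3 - 1 = 2.\<close>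

lemma surface_div_sphere:
  assumes "x \<in> sphere 0 R" "R > 0"
    and n: "\<And>y. y \<in> sphere 0 R \<Longrightarrow> n y = y /\<^sub>R R"
  shows "surface_div (sphere 0 R) n n x = 2 / R"
proof -
  let ?S = "sphere (0::R3) R"
  have nx: "norm x = R" "x \<noteq> 0" using assms by auto
  have "(n has_derivative (\<lambda>h. h /\<^sub>R R)) (at x within ?S)"
    by (rule has_derivative_transform[OF assms(1) n]) (auto intro!: derivative_eq_intros)
  then have D: "(n has_derivative frechet_derivative n (at x within ?S)) (at x within ?S)"
    using differentiable_def frechet_derivative_works by blast
  let ?D = "frechet_derivative n (at x within ?S)"
  have t: "?D v = v /\<^sub>R R" if "v \<bullet> x = 0" for v
  proof -
    have "((\<lambda>y. n y - y /\<^sub>R R) has_derivative (\<lambda>h. ?D h - h /\<^sub>R R)) (at x within ?S)"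
      by (auto intro!: derivative_eq_intros D)
    from has_derivative_zero_tangent[OF this, of UNIV v] show ?thesis
      using that n nx assms by auto
  qed
  have xx: "x \<bullet> x = R * R" using nx by (simp add: dot_square_norm power2_eq_square)
  have nR: "n x = x /\<^sub>R R" using assms by blast
  have "?D (h - (h \<bullet> n x) *\<^sub>R n x) = (h - (h \<bullet> n x) *\<^sub>R n x) /\<^sub>R R" for h
  proof (rule t)
    show "(h - (h \<bullet> n x) *\<^sub>R n x) \<bullet> x = 0"
      unfolding nR using xx \<open>R > 0\<close> by (simp add: inner_diff_left field_simps)
  qed
  then have "surface_div ?S n n x = (\<Sum>i\<in>UNIV. ((axis i 1 - (axis i 1 \<bullet> n x) *\<^sub>R n x) /\<^sub>R R) $ i)"
    by (simp add: surface_div_def trace_def matrix_def)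
  also have "\<dots> = (\<Sum>i\<in>UNIV. 1 / R - x $ i * x $ i / R ^ 3)"
    using \<open>R > 0\<close> by (intro sum.cong) (simp_all add: nR inner_axis' field_simps power3_eq_cube)
  also have "\<dots> = 3 / R - (x \<bullet> x) / R ^ 3"
    by (simp add: sum_subtractf inner_vec_def flip: sum_divide_distrib)
  also have "\<dots> = 2 / R" using xx \<open>R > 0\<close> by (simp add: field_simps power3_eq_cube)
  finally show ?thesis .
qed

section \<open>The mass-radius relation\<close>

text \<open>The inverse function theorem gives g' = 1/p'(g). Hence every derivative of
  \<open>g\<close> is a polynomial in \<open>g\<close> over a power of p'(g), a class closed under
  differentiation.\<close>

lemma smooth_poly_inverse:
  fixes p :: "real poly" and g :: "real \<Rightarrow> real"
  assumes inv: "\<And>r. r > 0 \<Longrightarrow> g (poly p r) = r"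
    and onto: "\<And>m. m > 0 \<Longrightarrow> g m > 0 \<and> poly p (g m) = m"
    and pos: "\<And>r. r > 0 \<Longrightarrow> poly (pderiv p) r > 0"
  shows "smooth_on_open {0<..} g"
proof -
  let ?d = "pderiv p"
  have dg: "(g has_real_derivative inverse (poly ?d (g m))) (at m)" if "m > 0" for m
  proof -
    have 1: "(poly p has_derivative (*) (poly ?d (g m))) (at (g m))"
      using poly_DERIV[of p "g m"] by (simp only: has_field_derivative_def)
    have 2: "(*) (poly ?d (g m)) \<circ> (*) (inverse (poly ?d (g m))) = id"
      using pos[of "g m"] onto[OF that] by (auto simp: fun_eq_iff)
    have "(g has_derivative (*) (inverse (poly ?d (g m)))) (at (poly p (g m)))"
      by (rule has_derivative_inverse_strong[OF _ _ _ _ 1 2, of "{0<..}"])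
         (use onto[OF that] inv in \<open>auto intro: continuous_intros\<close>)
    then have "(g has_real_derivative inverse (poly ?d (g m))) (at (poly p (g m)))"
      by (simp only: has_field_derivative_def)
    then show ?thesis using onto[OF that] by simp
  qed
  \<comment> \<open>The quotient rule raises the exponent by one, and the chain rule factor 1/p'(g)
    by one more, hence \<open>k + 2\<close>.\<close>
  have dq: "((\<lambda>m. poly q (g m) / poly ?d (g m) ^ k) has_real_derivative
     poly (pderiv q * ?d - smult (of_nat k) (q * pderiv ?d)) (g m) / poly ?d (g m) ^ (k + 2)) (at m)"
    if "m > 0" for m q k
  proof -
    define r where "r = g m"
    have r: "poly ?d r > 0" using pos onto that by (simp add: r_def)
    have "((\<lambda>r. poly q r / poly ?d r ^ k) has_real_derivative
       poly (pderiv q * ?d - smult (of_nat k) (q * pderiv ?d)) r / poly ?d r ^ (k + 1)) (at r)"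
      using r power_eq_if[of "poly ?d r" k]
      by (auto intro!: derivative_eq_intros simp: field_simps power2_eq_square)
    from DERIV_chain2[OF this[unfolded r_def] dg[OF that]]
    show ?thesis using r by (simp add: r_def field_simps)
  qed
  have form: "\<exists>q k. \<forall>m>0. (deriv ^^ j) g m = poly q (g m) / poly ?d (g m) ^ k" for j
  proof (induction j)
    case 0
    show ?case by (rule exI[of _ "[:0, 1:]"], rule exI[of _ 0]) simp
  next
    case (Suc j)
    then obtain q k where IH: "\<And>m. m > 0 \<Longrightarrow> (deriv ^^ j) g m = poly q (g m) / poly ?d (g m) ^ k"
      by blast
    have "(deriv ^^ Suc j) g m = poly (pderiv q * ?d - smult (of_nat k) (q * pderiv ?d)) (g m) / poly ?d (g m) ^ (k + 2)"
      if "m > 0" for m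
      unfolding funpow.simps o_apply
      by (rule DERIV_imp_deriv, rule has_field_derivative_transform_within_open[OF dq[OF that], of "{0<..}"])
         (use that IH in auto)
    then show ?case by blast
  qed
  have "((deriv ^^ j) g) differentiable_on {0<..}" for j
  proof -
    obtain q k where *: "\<And>m. m > 0 \<Longrightarrow> (deriv ^^ j) g m = poly q (g m) / poly ?d (g m) ^ k"
      using form by blast
    have "(deriv ^^ j) g differentiable (at m)" if "m > 0" for m
      using has_field_derivative_transform_within_open[OF dq[OF that], of "{0<..}" q k "(deriv ^^ j) g"] that *
      by (auto simp: real_differentiable_def)
    then show ?thesis by (auto simp: differentiable_on_def intro: differentiable_at_withinI)
  qed
  then show ?thesis by (simp add: smooth_on_open_def)
qed

lemma cubic_inverse:
  fixes a b :: real
  assumes "a > 0" "b > 0"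
  obtains g :: "real \<Rightarrow> real" where "smooth_on_open {0<..} g"
    "\<And>r. r > 0 \<Longrightarrow> g (a * r ^ 3 + b * r\<^sup>2) = r"
    "\<And>m. m > 0 \<Longrightarrow> g m > 0" "\<And>m. m > 0 \<Longrightarrow> a * g m ^ 3 + b * (g m)\<^sup>2 = m"
proof -
  define q where "q = [:0, 0, b, a:]"
  have p: "poly q r = a * r ^ 3 + b * r\<^sup>2" for r
    by (simp add: q_def power2_eq_square power3_eq_cube algebra_simps)
  have pos: "poly (pderiv q) r > 0" if "r > 0" for r
    using assms that by (simp add: q_def pderiv_pCons) (intro add_pos_pos mult_pos_pos; simp)
  have mono: "poly q r < poly q s" if "0 < r" "r < s" for r s
    unfolding p using assms that by (intro add_strict_mono mult_strict_left_mono power_strict_mono) auto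
  have ex: "\<exists>r>0. poly q r = m" if "m > 0" for m
  proof -
    \<comment> \<open>An upper end for the intermediate value theorem: \<open>a * ?u\<close> already
      exceeds \<open>m\<close>, and \<open>?u \<ge> 1\<close> lets the cube dominate
      \<open>?u\<close>.\<close>
    let ?u = "1 + m / a"
    have u: "?u \<ge> 1" using assms that by simp
    have "m \<le> a * ?u" using assms that by (simp add: field_simps)
    also have "\<dots> \<le> a * ?u ^ 3" using assms u by (intro mult_left_mono self_le_power) auto
    also have "\<dots> \<le> poly q ?u" using assms by (simp only: p) simp
    finally have "\<exists>r\<ge>0. r \<le> ?u \<and> poly q r = m"
      using that u p[of 0] by (intro IVT') (auto intro: continuous_intros)
    then obtain r where "0 \<le> r" "poly q r = m" by blast
    \<comment> \<open>The search interval starts at 0, where the cubic vanishes; positivity of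
      \<open>m\<close> excludes this root.\<close>
    then show ?thesis using that p[of 0] by (intro exI[of _ r]) (cases "r = 0"; simp)
  qed
  define g where "g m = (THE r. r > 0 \<and> poly q r = m)" for m
  have inv: "g (poly q r) = r" if "r > 0" for r
    unfolding g_def
    by (rule the_equality) (use that mono in \<open>metis linorder_cases order_less_irrefl\<close>)+
  have onto: "g m > 0 \<and> poly q (g m) = m" if "m > 0" for m
    using ex[OF that] inv by auto
  show ?thesis
    using that[of g] smooth_poly_inverse[of g q] inv onto pos unfolding p by blast
qed

section \<open>Rigidity of symmetric equilibria\<close>

lemma outer_prod_zero: "outer_prod 0 0 = 0"
  by (simp add: outer_prod_def vec_eq_iff)

text \<open>The radius is a parameter and the mass stays free, so that the mass can be expressed
  through the radius, both for a given equilibrium and for the explicit one constructed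
  later.\<close>

locale symmetric_equilibrium =
  fixes P :: bubble_params and p_infty R :: real and S :: bubble_state
  assumes params: "positive_params P"
    and equilibrium: "fs_equilibrium P p_infty S"
    and regular: "regular_state S"
    and symmetric: "spherically_symmetric S"
    and radiation: "radiation_condition P S"
    and R: "R > 0" and bubble: "bubble S = ball 0 R"
begin

abbreviation "e \<equiv> axis 1 1 :: R3"

lemma norm_e: "norm e = 1" by (simp add: norm_axis_1)

lemma system:
  "bubble_geometry S" "liquid_eqs P (\<lambda>t. S) t" "gas_eqs P (\<lambda>t. S) t" "interface_eqs P (\<lambda>t. S) t"
  "far_field P p_infty S"
  using equilibrium by (auto simp: fs_equilibrium_def fs_solution_def)

lemma interface: "interface S = sphere 0 R"
  using R by (simp add: bubble)

lemma liquid: "liquid S = {x. norm x \<in> {R<..}}"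
  using R by (auto simp: bubble)

lemma outside_eq_closure: "- bubble S = closure (liquid S)"
  using R by (simp add: bubble closure_complement)

text \<open>The complement of the open ball includes the interface, where the equations say nothing
  directly; continuity carries constant values there.\<close>

lemma constant_outside:
  fixes f :: "R3 \<Rightarrow> 'b::t1_space"
  assumes "continuous_on (- bubble S) f" "\<And>y. y \<in> liquid S \<Longrightarrow> f y = a" "x \<in> - bubble S"
  shows "f x = a"
  using continuous_constant_on_closure[of "liquid S" f a x] assms
  unfolding outside_eq_closure[symmetric] by blast

lemma gas_closure: "closure (bubble S) = cball 0 R"
  using R by (simp add: bubble)

lemma open_liquid: "open (liquid S)" and open_bubble: "open (bubble S)"
  by (simp_all add: bubble open_Compl)

lemma Re_on_interface: "R *\<^sub>R e \<in> interface S"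
  using R by (simp add: interface norm_axis_1)

lemma normal: "x \<in> interface S \<Longrightarrow> surf_normal S x = x /\<^sub>R R"
  using system(1) outer_unit_normal_ball by (simp add: bubble_geometry_def bubble)

text \<open>The parametrization reaches every interface point and does not depend on time, so the
  interface velocity is zero.\<close>

lemma impermeable:
  assumes "x \<in> interface S"
  shows "v_liq S x \<bullet> surf_normal S x = 0"
proof -
  obtain \<alpha> where "\<alpha> \<in> sphere 0 1" "x = surf_param S \<alpha>"
    using system(1) assms unfolding bubble_geometry_def homeomorphism_def by blast
  then show ?thesis using system(4)
    by (auto simp: interface_eqs_def Let_def time_deriv_def)
qed

section \<open>The liquid phase\<close>

lemma liquid_eqs:
  assumes "x \<in> liquid S"
  shows "tensor_div (\<lambda>y. rho_l P *\<^sub>R outer_prod (v_liq S y) (v_liq S y)) x = tensor_div (stress_liq P S) x"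
    and "divergence (v_liq S) x = 0"
    and "rho_l P * c_l P * (v_liq S x \<bullet> gradient (T_liq S) x)
       = divergence (\<lambda>y. kappa_l P *\<^sub>R gradient (T_liq S) y) x
         + visc_liq P S x \<bullet> jacobian (v_liq S) (at x)"
  using system(2)[unfolded liquid_eqs_def Let_def time_deriv_def vector_derivative_const_at add_0, rule_format, OF assms]
  by blast+

text \<open>Incompressibility is available for r > R, impermeability at r = R. Continuity of the
  velocity up to the interface connects the two: the constant flux outside equals the flux at
  \<open>R\<close>, which is zero.\<close>

lemma liquid_at_rest:
  assumes "x \<in> - bubble S"
  shows "v_liq S x = 0"
proof -
  have cont: "continuous_on (- bubble S) (v_liq S)" using regular by (simp add: regular_state_def)
  obtain g where g: "\<And>x. x \<in> - bubble S \<Longrightarrow> x \<noteq> 0 \<Longrightarrow> v_liq S x = g (norm x) *\<^sub>R (x /\<^sub>R norm x)"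
    using symmetric unfolding spherically_symmetric_def radial_vec_on_def by (metis DiffI singletonD)
  obtain c where c: "\<And>r. r \<in> {R<..} \<Longrightarrow> r\<^sup>2 * g r = c"
  proof (rule radial_solenoidal[of "{R<..}" "v_liq S" g])
    fix x :: R3 assume x: "norm x \<in> {R<..}"
    then have xl: "x \<in> liquid S" by (simp only: liquid mem_Collect_eq)
    show "v_liq S x = g (norm x) *\<^sub>R (x /\<^sub>R norm x)"
      using x R by (intro g) (auto simp: bubble)
    show "v_liq S differentiable (at x)"
      using regular xl by (simp add: regular_state_def C2_on_def C1_on_def)
    show "divergence (v_liq S) x = 0" by (rule liquid_eqs(2)[OF xl])
  qed (use R in auto)
  have ray: "v_liq S (r *\<^sub>R e) \<bullet> e = g r" if "r \<ge> R" for r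
    using g[of "r *\<^sub>R e"] that R by (simp add: bubble norm_axis_1 inner_axis_axis)
  have "R *\<^sub>R e \<bullet> R *\<^sub>R e = R * R" by (simp add: inner_axis_axis)
  then have gR: "g R = 0"
    using impermeable[OF Re_on_interface] ray[of R] R by (simp add: normal[OF Re_on_interface])
  have "continuous_on {R..} (\<lambda>r. v_liq S (r *\<^sub>R e))"
    by (rule continuous_on_compose2[OF cont]) (use R in \<open>auto intro!: continuous_intros simp: bubble norm_axis_1\<close>)
  then have "continuous_on {R..} (\<lambda>r. r\<^sup>2 * (v_liq S (r *\<^sub>R e) \<bullet> e))"
    by (intro continuous_intros)
  moreover have "r\<^sup>2 * (v_liq S (r *\<^sub>R e) \<bullet> e) = c" if "r \<in> {R<..}" for r
    using ray[of r] c[OF that] that by simp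
  moreover have "closure {R<..} = {R..}" by (rule closure_greaterThan)
  ultimately have "R\<^sup>2 * (v_liq S (R *\<^sub>R e) \<bullet> e) = c"
    using continuous_constant_on_closure[of "{R<..}" "\<lambda>r. r\<^sup>2 * (v_liq S (r *\<^sub>R e) \<bullet> e)" c R]
    by (metis atLeast_iff order_refl)
  then have "c = 0" using ray[of R] gR by simp
  have "g (norm x) = 0"
  proof (cases "norm x = R")
    case False
    then have "norm x \<in> {R<..}" using assms by (simp add: bubble)
    moreover from this have "norm x \<noteq> 0" using R by auto
    ultimately show ?thesis using c[of "norm x"] \<open>c = 0\<close> by simp
  qed (simp add: gR)
  moreover have "x \<noteq> 0" using assms R by (auto simp: bubble)
  ultimately show ?thesis using g[OF assms] by simp
qed

lemma v_liq_zero: "x \<in> liquid S \<Longrightarrow> v_liq S x = 0"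
  using liquid_at_rest closure_subset by blast

lemma jacobian_liq: "x \<in> liquid S \<Longrightarrow> jacobian (v_liq S) (at x) = 0"
  by (rule jacobian_zero_on_open[OF open_liquid _ v_liq_zero])

lemma visc_liq: "x \<in> liquid S \<Longrightarrow> visc_liq P S x = 0"
  by (simp add: visc_liq_def deformation_eq_0 jacobian_liq)

lemma stress_liq: "x \<in> liquid S \<Longrightarrow> stress_liq P S x = - (p_liq S x *\<^sub>R mat 1)"
  by (simp add: stress_liq_def visc_liq)

text \<open>The velocity vanishes on the whole open liquid, so convective and viscous terms vanish
  together with their derivatives, and only hydrostatic balance remains.\<close>

lemma liquid_pressure_gradient:
  assumes x: "x \<in> liquid S"
  shows "gradient (p_liq S) x = 0"
proof -
  have "tensor_div (\<lambda>y. rho_l P *\<^sub>R outer_prod (v_liq S y) (v_liq S y)) x = tensor_div (\<lambda>y. 0) x"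
    by (rule tensor_div_cong_open[OF open_liquid x]) (simp only: v_liq_zero outer_prod_zero scaleR_zero_right)
  then have "tensor_div (stress_liq P S) x = 0"
    by (simp only: liquid_eqs(1)[OF x] tensor_div_const)
  moreover have "tensor_div (stress_liq P S) x = - gradient (p_liq S) x"
    by (rule tensor_div_pressure[OF open_liquid x stress_liq])
       (use regular x in \<open>simp_all only: regular_state_def C1_on_def\<close>)
  ultimately show ?thesis by simp
qed

lemma liquid_pressure:
  assumes "x \<in> - bubble S"
  shows "p_liq S x = p_infty"
proof -
  obtain h where h: "\<And>x. x \<in> - bubble S \<Longrightarrow> p_liq S x = h (norm x)"
    using symmetric unfolding spherically_symmetric_def radial_on_def by blast
  obtain c where c: "\<And>x. norm x \<in> {R<..} \<Longrightarrow> p_liq S x = c"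
  proof (rule radial_gradient_zero[of "{R<..}" "p_liq S" h])
    fix x :: R3 assume x: "norm x \<in> {R<..}"
    then have xl: "x \<in> liquid S" by (simp only: liquid mem_Collect_eq)
    show "p_liq S x = h (norm x)" using x by (intro h) (simp add: bubble)
    show "p_liq S differentiable (at x)"
      using regular xl by (simp add: regular_state_def C1_on_def)
    show "gradient (p_liq S) x = 0" by (rule liquid_pressure_gradient[OF xl])
  qed (use R in auto)
  \<comment> \<open>The far field along a single ray identifies the constant.\<close>
  have "((\<lambda>r. p_liq S (r *\<^sub>R e)) \<longlongrightarrow> p_infty) at_top"
    using system(5) by (intro filterlim_compose[OF _ ray_at_infinity[OF norm_e]]) (simp add: far_field_def)
  moreover have "eventually (\<lambda>r. p_liq S (r *\<^sub>R e) = c) at_top"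
    using eventually_gt_at_top[of R]
  proof eventually_elim
    case (elim r)
    then show ?case using R by (intro c) (simp add: norm_axis_1)
  qed
  ultimately have "((\<lambda>r::real. c) \<longlongrightarrow> p_infty) at_top" by (rule Lim_transform_eventually)
  then have "c = p_infty" by (simp add: tendsto_const_iff)
  then have "p_liq S y = p_infty" if "y \<in> liquid S" for y
    using c that by (simp add: liquid)
  moreover have "continuous_on (- bubble S) (p_liq S)"
    using regular by (simp only: regular_state_def)
  ultimately show ?thesis using constant_outside assms by blast
qed

text \<open>At rest both convection and viscous heating drop out of the heat equation, so the
  exterior result for harmonic functions applies.\<close>

lemma liquid_temperature:
  assumes "x \<in> - bubble S"
  shows "T_liq S x = T_inf P"
proof -
  obtain h where h: "\<And>x. x \<in> - bubble S \<Longrightarrow> T_liq S x = h (norm x)"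
    using symmetric unfolding spherically_symmetric_def radial_on_def by blast
  have "T_liq S y = T_inf P" if "y \<in> liquid S" for y
  proof (rule exterior_radial_harmonic[of R "kappa_l P" "T_liq S" h "liquid S"])
    fix x :: R3 assume x: "norm x \<in> {R<..}"
    then show xl: "x \<in> liquid S" by (simp only: liquid mem_Collect_eq)
    show "T_liq S x = h (norm x)" using x by (intro h) (simp add: bubble)
    have "v_liq S x = 0" by (rule v_liq_zero[OF xl])
    then show "divergence (\<lambda>y. kappa_l P *\<^sub>R gradient (T_liq S) y) x = 0"
      using liquid_eqs(3)[OF xl] by (simp add: visc_liq[OF xl])
  next
    show "R < norm y" using that by (simp add: liquid)
    show "C2_on (liquid S) (T_liq S)" using regular by (simp add: regular_state_def)
    show "(T_liq S \<longlongrightarrow> T_inf P) at_infinity" using system(5) by (simp add: far_field_def)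
    show "(\<lambda>x. T_liq S x - T_inf P) \<in> o[at_infinity](\<lambda>x. inverse (norm x))"
      using radiation by (simp add: radiation_condition_def)
  qed (use R params in \<open>auto simp: positive_params_def\<close>)
  moreover have "continuous_on (- bubble S) (T_liq S)"
    using regular by (simp only: regular_state_def)
  ultimately show ?thesis using constant_outside assms by blast
qed

section \<open>The gas phase\<close>

lemma gas_eqs:
  assumes "x \<in> bubble S"
  shows "rho_gas S x > 0" "divergence (\<lambda>y. rho_gas S y *\<^sub>R v_gas S y) x = 0"
    "tensor_div (\<lambda>y. rho_gas S y *\<^sub>R outer_prod (v_gas S y) (v_gas S y)) x = tensor_div (stress_gas P S) x"
    "rho_gas S x * T_gas S x * (v_gas S x \<bullet> gradient (s_gas S) x)
       = divergence (\<lambda>y. kappa_g P *\<^sub>R gradient (T_gas S) y) x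
         + visc_gas P S x \<bullet> jacobian (v_gas S) (at x)"
    "p_gas S x = gas_const P * T_gas S x * rho_gas S x"
    "s_gas S x = c_v P * ln (p_gas S x / rho_gas S x powr gamma_exp P)"
  using system(3)[unfolded gas_eqs_def Let_def time_deriv_def vector_derivative_const_at add_0, rule_format, OF assms]
  by blast+

lemma gas_regular:
  assumes "x \<in> bubble S"
  shows "rho_gas S differentiable (at x)" "v_gas S differentiable (at x)"
    "p_gas S differentiable (at x)"
  using regular assms by (auto simp: regular_state_def C1_on_def C2_on_def)

lemma gas_continuous:
  "continuous_on (cball 0 R) (rho_gas S)" "continuous_on (cball 0 R) (v_gas S)"
  "continuous_on (cball 0 R) (p_gas S)" "continuous_on (cball 0 R) (T_gas S)"
  "continuous_on (cball 0 R) (s_gas S)"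
  using regular by (simp_all add: regular_state_def gas_closure)

text \<open>The density is not yet known to be constant, so the solenoidal field is the momentum
  rather than the velocity. Once the momentum vanishes, positivity of the density allows it to be
  divided out.\<close>

lemma gas_at_rest:
  assumes "x \<in> closure (bubble S)"
  shows "v_gas S x = 0"
proof -
  obtain g where g: "\<And>x. x \<in> cball 0 R \<Longrightarrow> x \<noteq> 0 \<Longrightarrow> v_gas S x = g (norm x) *\<^sub>R (x /\<^sub>R norm x)"
    using symmetric unfolding spherically_symmetric_def radial_vec_on_def gas_closure
    by (metis DiffI singletonD)
  obtain k where k: "\<And>x. x \<in> cball 0 R \<Longrightarrow> rho_gas S x = k (norm x)"
    using symmetric unfolding spherically_symmetric_def radial_on_def gas_closure by blast
  define w where "w = (\<lambda>y. rho_gas S y *\<^sub>R v_gas S y)"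
  have dw: "w differentiable (at x)" if "x \<in> bubble S" for x
    unfolding w_def using gas_regular[OF that] by (intro differentiable_scaleR)
  have w: "w x = (k (norm x) * g (norm x)) *\<^sub>R (x /\<^sub>R norm x)" if "norm x \<in> {0<..<R}" for x
    using g[of x] k[of x] that by (auto simp: w_def)
  obtain c where c: "\<And>r. r \<in> {0<..<R} \<Longrightarrow> r\<^sup>2 * (k r * g r) = c"
  proof (rule radial_solenoidal[of "{0<..<R}" w "\<lambda>r. k r * g r"])
    fix x :: R3 assume x: "norm x \<in> {0<..<R}"
    then have xb: "x \<in> bubble S" by (simp add: bubble)
    show "w x = (k (norm x) * g (norm x)) *\<^sub>R (x /\<^sub>R norm x)" by (rule w[OF x])
    show "w differentiable (at x)" by (rule dw[OF xb])
    show "divergence w x = 0" unfolding w_def by (rule gas_eqs(2)[OF xb])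
  qed auto
  have "c = 0"
  proof (rule central_flux_zero)
    show "isCont w 0" using dw[of 0] R by (simp add: bubble differentiable_imp_continuous_within)
    show "r\<^sup>2 * (w (r *\<^sub>R e) \<bullet> e) = c" if "r \<in> {0<..<R}" for r
      using w[of "r *\<^sub>R e"] c[OF that] that by (simp add: norm_axis_1 inner_axis_axis)
  qed (rule R)
  have "v_gas S y = 0" if y: "norm y \<in> {0<..<R}" for y
  proof -
    have "k (norm y) > 0" using gas_eqs(1)[of y] k[of y] y by (simp add: bubble)
    then have "g (norm y) = 0" using c[OF y] y \<open>c = 0\<close> by auto
    then show ?thesis using g[of y] y by auto
  qed
  then show ?thesis
    using constant_on_cball_if_punctured[OF gas_continuous(2) R] assms unfolding gas_closure by blast
qed

lemma v_gas_zero: "x \<in> bubble S \<Longrightarrow> v_gas S x = 0"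
  using gas_at_rest closure_subset by blast

lemma jacobian_gas: "x \<in> bubble S \<Longrightarrow> jacobian (v_gas S) (at x) = 0"
  by (rule jacobian_zero_on_open[OF open_bubble _ v_gas_zero])

lemma visc_gas: "x \<in> bubble S \<Longrightarrow> visc_gas P S x = 0"
  by (simp add: visc_gas_def deformation_eq_0 divergence_eq_0 jacobian_gas)

lemma stress_gas: "x \<in> bubble S \<Longrightarrow> stress_gas P S x = - (p_gas S x *\<^sub>R mat 1)"
  by (simp add: stress_gas_def visc_gas)

lemma gas_pressure_gradient:
  assumes x: "x \<in> bubble S"
  shows "gradient (p_gas S) x = 0"
proof -
  have "tensor_div (\<lambda>y. rho_gas S y *\<^sub>R outer_prod (v_gas S y) (v_gas S y)) x = tensor_div (\<lambda>y. 0) x"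
    by (rule tensor_div_cong_open[OF open_bubble x]) (simp only: v_gas_zero outer_prod_zero scaleR_zero_right)
  then have "tensor_div (stress_gas P S) x = 0"
    by (simp only: gas_eqs(3)[OF x] tensor_div_const)
  moreover have "tensor_div (stress_gas P S) x = - gradient (p_gas S) x"
    by (rule tensor_div_pressure[OF open_bubble x stress_gas gas_regular(3)[OF x]])
  ultimately show ?thesis by simp
qed

text \<open>The constant stays anonymous here; its value depends on the stress balance at the
  interface.\<close>

lemma gas_pressure_constant: "\<exists>pg. \<forall>x \<in> cball 0 R. p_gas S x = pg"
proof -
  obtain h where h: "\<And>x. x \<in> cball 0 R \<Longrightarrow> p_gas S x = h (norm x)"
    using symmetric unfolding spherically_symmetric_def radial_on_def gas_closure by blast
  obtain c where c: "\<And>x. norm x \<in> {0<..<R} \<Longrightarrow> p_gas S x = c"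
    by (rule radial_gradient_zero[of "{0<..<R}" "p_gas S" h])
       (use h gas_regular(3) gas_pressure_gradient in \<open>auto simp: bubble\<close>)
  show ?thesis
    using constant_on_cball_if_punctured[OF gas_continuous(3) R c] by blast
qed

lemma gas_temperature:
  assumes "x \<in> closure (bubble S)"
  shows "T_gas S x = T_inf P"
proof -
  obtain h where h: "\<And>x. x \<in> cball 0 R \<Longrightarrow> T_gas S x = h (norm x)"
    using symmetric unfolding spherically_symmetric_def radial_on_def gas_closure by blast
  have C2: "C2_on (bubble S) (T_gas S)" using regular by (simp add: regular_state_def)
  obtain c where c: "\<And>r. r \<in> {0<..<R} \<Longrightarrow> (h has_real_derivative c / r\<^sup>2) (at r)"
    "\<And>x. norm x \<in> {0<..<R} \<Longrightarrow> gradient (T_gas S) x = (c / (norm x)\<^sup>2) *\<^sub>R (x /\<^sub>R norm x)"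
  proof (rule radial_harmonic[of "{0<..<R}" "kappa_g P" "T_gas S" h "bubble S"])
    fix x :: R3 assume x: "norm x \<in> {0<..<R}"
    then show xb: "x \<in> bubble S" by (simp add: bubble)
    show "T_gas S x = h (norm x)" using x by (intro h) simp
    have "v_gas S x = 0" by (rule v_gas_zero[OF xb])
    then show "divergence (\<lambda>y. kappa_g P *\<^sub>R gradient (T_gas S) y) x = 0"
      using gas_eqs(4)[OF xb] by (simp add: visc_gas[OF xb])
  qed (use C2 params in \<open>auto simp: positive_params_def\<close>)
  \<comment> \<open>Two continuous derivatives at the origin make the temperature gradient
    continuous there, which excludes an inverse-square gradient.\<close>
  have "c = 0"
  proof (rule central_flux_zero)
    show "isCont (gradient (T_gas S)) 0"
      using C2_on_gradient[OF C2, of 0] R by (simp add: bubble differentiable_imp_continuous_within)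
    show "r\<^sup>2 * (gradient (T_gas S) (r *\<^sub>R e) \<bullet> e) = c" if "r \<in> {0<..<R}" for r
      using c(2)[of "r *\<^sub>R e"] that by (simp add: norm_axis_1 inner_axis_axis)
  qed (rule R)
  then have "(h has_real_derivative 0) (at r within {0<..<R})" if "r \<in> {0<..<R}" for r
    using c(1)[OF that] by (simp add: has_field_derivative_at_within)
  from has_field_derivative_zero_constant[OF _ this] obtain a where
    a: "\<And>r. r \<in> {0<..<R} \<Longrightarrow> h r = a" by auto
  have "T_gas S x = a" if "x \<in> cball 0 R" for x
    by (rule constant_on_cball_if_punctured[OF gas_continuous(4) R _ that]) (use h a in auto)
  \<comment> \<open>One interface point suffices to pass the liquid temperature on to the constant
    gas temperature.\<close>
  moreover have "T_gas S (R *\<^sub>R e) = T_liq S (R *\<^sub>R e)"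
    using system(4) Re_on_interface by (simp add: interface_eqs_def Let_def)
  moreover have "R *\<^sub>R e \<in> - bubble S" "R *\<^sub>R e \<in> cball 0 R" using R by (auto simp: bubble norm_axis_1)
  ultimately show ?thesis using liquid_temperature assms unfolding gas_closure by metis
qed

lemma gas_pressure:
  assumes "x \<in> closure (bubble S)"
  shows "p_gas S x = p_infty + 2 * surf_tension P / R"
proof -
  obtain pg where pg: "\<And>x. x \<in> cball 0 R \<Longrightarrow> p_gas S x = pg" using gas_pressure_constant by blast
  let ?x = "R *\<^sub>R e"
  obtain A B where AB: "(stress_liq P S \<longlongrightarrow> A) (at ?x within liquid S)"
      "(stress_gas P S \<longlongrightarrow> B) (at ?x within bubble S)"
      "surf_normal S ?x v* A - surf_normal S ?x v* B
        = (surf_tension P * surface_div (interface S) (surf_normal S) (surf_normal S) ?x) *\<^sub>R surf_normal S ?x"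
    using system(4)[unfolded interface_eqs_def Let_def] Re_on_interface by blast
  \<comment> \<open>The one-sided limits \<open>A\<close> and \<open>B\<close> are unique only if
    \<open>?x\<close> is a limit point of both phases; along a trivial filter they would be
    arbitrary.\<close>
  have "?x islimpt liquid S"
  proof -
    have "?x \<in> - bubble S" using R by (simp add: bubble norm_axis_1)
    then have "?x \<in> closure (liquid S)" by (simp only: outside_eq_closure)
    moreover have "?x \<notin> liquid S" using R by (simp add: liquid norm_axis_1)
    ultimately show ?thesis by (simp only: closure_def Un_iff mem_Collect_eq simp_thms)
  qed
  moreover have "?x islimpt bubble S"
    using R by (simp add: bubble islimpt_ball norm_axis_1)
  ultimately have nontrivial: "at ?x within liquid S \<noteq> bot" "at ?x within bubble S \<noteq> bot"
    by (simp_all only: trivial_limit_within simp_thms)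
  have "stress_liq P S y = - (p_infty *\<^sub>R mat 1)" if "y \<in> liquid S" for y
  proof -
    have "y \<in> - bubble S" using that closure_subset by blast
    then show ?thesis by (simp only: stress_liq[OF that] liquid_pressure)
  qed
  then have "eventually (\<lambda>y. stress_liq P S y = - (p_infty *\<^sub>R mat 1)) (at ?x within liquid S)"
    unfolding eventually_at_filter by (intro always_eventually) blast
  with AB(1) have "((\<lambda>y. - (p_infty *\<^sub>R mat 1)) \<longlongrightarrow> A) (at ?x within liquid S)"
    by (rule Lim_transform_eventually)
  then have A: "A = - (p_infty *\<^sub>R mat 1)"
    using nontrivial(1) by (simp add: tendsto_const_iff)
  have "stress_gas P S y = - (pg *\<^sub>R mat 1)" if "y \<in> bubble S" for y
  proof -
    have "y \<in> cball 0 R" using that by (simp add: bubble)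
    then show ?thesis by (simp only: stress_gas[OF that] pg)
  qed
  then have "eventually (\<lambda>y. stress_gas P S y = - (pg *\<^sub>R mat 1)) (at ?x within bubble S)"
    unfolding eventually_at_filter by (intro always_eventually) blast
  with AB(2) have "((\<lambda>y. - (pg *\<^sub>R mat 1)) \<longlongrightarrow> B) (at ?x within bubble S)"
    by (rule Lim_transform_eventually)
  then have B: "B = - (pg *\<^sub>R mat 1)"
    using nontrivial(2) by (simp add: tendsto_const_iff)
  have n: "surf_normal S ?x = e" using normal[OF Re_on_interface] R by simp
  have div: "surface_div (interface S) (surf_normal S) (surf_normal S) ?x = 2 / R"
    unfolding interface using Re_on_interface R normal by (intro surface_div_sphere) (auto simp: interface)
  \<comment> \<open>At this point the normal is \<open>e\<close>, so the first component of the
    stress balance is the Young-Laplace law.\<close>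
  have "(e v* A - e v* B) $ 1 = pg - p_infty"
    by (simp add: A B vector_matrix_mult_def mat_def axis_def sum_3)
  moreover have "(e v* A - e v* B) $ 1 = surf_tension P * (2 / R)"
    using AB(3) unfolding n div by simp
  ultimately have "pg - p_infty = surf_tension P * (2 / R)" by (simp only:)
  moreover have "p_gas S x = pg" using assms by (intro pg) (simp only: gas_closure)
  ultimately show ?thesis by (simp add: algebra_simps)
qed

lemma gas_density:
  assumes "x \<in> closure (bubble S)"
  shows "rho_gas S x = 1 / (gas_const P * T_inf P) * (p_infty + 2 * surf_tension P / R)"
proof (rule continuous_constant_on_closure[OF _ _ assms])
  show "continuous_on (closure (bubble S)) (rho_gas S)"
    using gas_continuous(1) by (simp only: gas_closure)
  fix x assume x: "x \<in> bubble S"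
  then have "x \<in> closure (bubble S)" using closure_subset by blast
  note pT = gas_pressure[OF this] gas_temperature[OF this]
  show "rho_gas S x = 1 / (gas_const P * T_inf P) * (p_infty + 2 * surf_tension P / R)"
    using gas_eqs(5)[OF x] params unfolding pT by (auto simp: positive_params_def)
qed

lemma gas_entropy:
  assumes "p_infty > 0" and "x \<in> closure (bubble S)"
  shows "s_gas S x = c_v P * ln ((gas_const P * T_inf P) powr gamma_exp P
            * (p_infty + 2 * surf_tension P / R) powr (1 - gamma_exp P))"
proof (rule continuous_constant_on_closure[OF _ _ assms(2)])
  show "continuous_on (closure (bubble S)) (s_gas S)"
    using gas_continuous(5) by (simp only: gas_closure)
  fix x assume x: "x \<in> bubble S"
  then have "x \<in> closure (bubble S)" using closure_subset by blast
  note gas = gas_pressure[OF this] gas_density[OF this]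
  \<comment> \<open>With these abbreviations the density is \<open>p / a\<close>, and the logarithm
    in the entropy acts on p/(p/a)^\<gamma>; positivity of both allows the powers to be
    split.\<close>
  define p a where "p = p_infty + 2 * surf_tension P / R" and "a = gas_const P * T_inf P"
  have "p > 0" "a > 0"
    using assms(1) params R by (auto simp: p_def a_def positive_params_def intro!: add_pos_pos)
  then have "p / (1 / a * p) powr gamma_exp P = a powr gamma_exp P * p powr (1 - gamma_exp P)"
    by (simp add: powr_mult powr_divide powr_diff)
  then show "s_gas S x = c_v P * ln ((gas_const P * T_inf P) powr gamma_exp P
            * (p_infty + 2 * surf_tension P / R) powr (1 - gamma_exp P))"
    using gas_eqs(6)[OF x] unfolding gas p_def a_def by simp
qed

text \<open>The density is constant, so the mass is density times ball volume. The capillary term 2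
  \<sigma> / R lowers the degree by one, which is the source of the quadratic term.\<close>

lemma mass:
  "bubble_mass S = 4 * pi / (3 * gas_const P * T_inf P) * (p_infty * R ^ 3 + 2 * surf_tension P * R\<^sup>2)"
proof -
  let ?d = "1 / (gas_const P * T_inf P) * (p_infty + 2 * surf_tension P / R)"
  have "bubble_mass S = integral (ball 0 R :: R3 set) (\<lambda>x. ?d * 1)"
    unfolding bubble_mass_def bubble
    by (rule integral_cong) (use gas_density gas_closure in simp)
  also have "\<dots> = ?d * integral (ball 0 R :: R3 set) (\<lambda>x. 1)"
    by (rule integral_mult_right)
  also have "integral (ball 0 R :: R3 set) (\<lambda>x. 1::real) = measure lborel (ball 0 R :: R3 set)"
    by (subst lmeasure_integral[symmetric]) simp_all
  also have "measure lborel (ball 0 R :: R3 set) = 4 / 3 * R ^ 3 * pi"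
    using R by (simp add: sphere_volume)
  also have "?d * (4 / 3 * R ^ 3 * pi)
      = 4 * pi / (3 * gas_const P * T_inf P) * ((p_infty + 2 * surf_tension P / R) * R ^ 3)"
    by (simp add: ac_simps)
  also have "(p_infty + 2 * surf_tension P / R) * R ^ 3 = p_infty * R ^ 3 + 2 * surf_tension P * R\<^sup>2"
    using R by (simp add: field_simps power2_eq_square power3_eq_cube)
  finally show ?thesis .
qed

end

section \<open>Existence\<close>

lemma C1_on_const: "C1_on U (\<lambda>x. c)"
  by (simp add: C1_on_def frechet_derivative_eqI[OF has_derivative_const])

lemma C2_on_const: "C2_on U (\<lambda>x. c)"
  by (simp add: C2_on_def C1_on_const frechet_derivative_eqI[OF has_derivative_const])

lemma jacobian_const: "jacobian (\<lambda>x. 0 :: R3) (at x) = 0"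
  by (rule jacobian_zero_on_open[of UNIV]) simp_all

text \<open>Each liquid and gas field is constant on all of space, so its full derivatives vanish at
  every point. The entropy is entered through the equation of state; its closed form then follows
  from \<open>gas_entropy\<close>.\<close>

definition equilibrium_state :: "bubble_params \<Rightarrow> real \<Rightarrow> real \<Rightarrow> bubble_state" where
  "equilibrium_state P p_infty R = (let p = p_infty + 2 * surf_tension P / R;
      \<rho> = p / (gas_const P * T_inf P) in
    \<lparr>bubble = ball 0 R, v_liq = (\<lambda>x. 0), p_liq = (\<lambda>x. p_infty), T_liq = (\<lambda>x. T_inf P),
     rho_gas = (\<lambda>x. \<rho>), v_gas = (\<lambda>x. 0), p_gas = (\<lambda>x. p), T_gas = (\<lambda>x. T_inf P),
     s_gas = (\<lambda>x. c_v P * ln (p / \<rho> powr gamma_exp P)),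
     surf_param = (\<lambda>\<alpha>. R *\<^sub>R \<alpha>), surf_normal = (\<lambda>x. x /\<^sub>R R)\<rparr>)"

lemma equilibrium_state_stress:
  "visc_liq P (equilibrium_state P p_infty R) = (\<lambda>x. 0)"
  "visc_gas P (equilibrium_state P p_infty R) = (\<lambda>x. 0)"
  "stress_liq P (equilibrium_state P p_infty R) = (\<lambda>x. - (p_infty *\<^sub>R mat 1))"
  "stress_gas P (equilibrium_state P p_infty R) = (\<lambda>x. - ((p_infty + 2 * surf_tension P / R) *\<^sub>R mat 1))"
  by (auto simp: equilibrium_state_def Let_def visc_liq_def visc_gas_def stress_liq_def stress_gas_def
      deformation_eq_0 jacobian_const)

lemma equilibrium_state_geometry:
  assumes "R > 0"
  shows "bubble_geometry (equilibrium_state P p_infty R)"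
proof -
  have "homeomorphism (sphere 0 1) (sphere 0 R) (\<lambda>\<alpha>. R *\<^sub>R \<alpha>) (\<lambda>x :: R3. x /\<^sub>R R)"
  proof (rule homeomorphismI)
    show "(\<lambda>\<alpha> :: R3. R *\<^sub>R \<alpha>) ` sphere 0 1 \<subseteq> sphere 0 R"
      "(\<lambda>x :: R3. x /\<^sub>R R) ` sphere 0 R \<subseteq> sphere 0 1"
      using assms by auto
  qed (use assms in \<open>auto intro!: continuous_intros\<close>)
  moreover have "(\<lambda>x :: R3. x /\<^sub>R R) differentiable_on sphere 0 R"
    by (intro differentiable_at_imp_differentiable_on) simp
  ultimately show ?thesis
    using assms outer_unit_normal_ball_self
    by (auto simp: bubble_geometry_def equilibrium_state_def Let_def convex_imp_simply_connected)
qed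

text \<open>Constant stresses are their own one-sided limits, and the gas pressure was chosen so
  that their difference is the capillary jump.\<close>

lemma equilibrium_state_interface_eqs:
  assumes "R > 0"
  shows "interface_eqs P (\<lambda>t. equilibrium_state P p_infty R) t"
proof -
  let ?S = "equilibrium_state P p_infty R"
  define q where "q = p_infty + 2 * surf_tension P / R"
  have S: "bubble ?S = ball 0 R" "surf_normal ?S = (\<lambda>x. x /\<^sub>R R)" "v_liq ?S = (\<lambda>x. 0)"
    "v_gas ?S = (\<lambda>x. 0)" "T_gas ?S = T_liq ?S"
    by (simp_all add: equilibrium_state_def Let_def)
  have "n v* (- (p_infty *\<^sub>R mat 1)) - n v* (- (q *\<^sub>R mat 1)) = (q - p_infty) *\<^sub>R n" for n :: R3
    by (simp add: vec_eq_iff vector_matrix_mult_def mat_def if_distrib sum_negf algebra_simps cong: if_cong)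
  moreover have "q - p_infty = surf_tension P * (2 / R)" by (simp add: q_def)
  ultimately have jump: "n v* (- (p_infty *\<^sub>R mat 1)) - n v* (- (q *\<^sub>R mat 1))
      = (surf_tension P * (2 / R)) *\<^sub>R n" for n :: R3
    by simp
  have "surface_div (sphere 0 R) (\<lambda>x. x /\<^sub>R R) (\<lambda>x. x /\<^sub>R R) x = 2 / R" if "x \<in> sphere 0 R" for x
    by (rule surface_div_sphere[OF that assms]) simp
  then have "\<exists>A B. (stress_liq P ?S \<longlongrightarrow> A) (at x within liquid ?S) \<and>
        (stress_gas P ?S \<longlongrightarrow> B) (at x within bubble ?S) \<and>
        surf_normal ?S x v* A - surf_normal ?S x v* B
          = (surf_tension P * surface_div (interface ?S) (surf_normal ?S) (surf_normal ?S) x) *\<^sub>R surf_normal ?S x"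
    if "x \<in> interface ?S" for x
    using that unfolding equilibrium_state_stress S q_def[symmetric] frontier_ball[OF assms]
    by (intro exI[of _ "- (p_infty *\<^sub>R mat 1)"] exI[of _ "- (q *\<^sub>R mat 1)"] conjI tendsto_const)
       (simp only: jump)
  then show ?thesis
    unfolding interface_eqs_def Let_def
    by (auto simp: S time_deriv_def)
qed

lemma equilibrium_state_equilibrium:
  assumes "positive_params P" "p_infty > 0" "R > 0"
  shows "fs_equilibrium P p_infty (equilibrium_state P p_infty R)"
proof -
  let ?S = "equilibrium_state P p_infty R"
  define q where "q = p_infty + 2 * surf_tension P / R"
  have pos: "q > 0" "gas_const P > 0" "T_inf P > 0"
    using assms by (auto simp: q_def positive_params_def intro!: add_pos_pos)
  have S: "v_liq ?S = (\<lambda>x. 0)" "T_liq ?S = (\<lambda>x. T_inf P)" "p_liq ?S = (\<lambda>x. p_infty)"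
    "v_gas ?S = (\<lambda>x. 0)" "T_gas ?S = (\<lambda>x. T_inf P)" "p_gas ?S = (\<lambda>x. q)"
    "rho_gas ?S = (\<lambda>x. q / (gas_const P * T_inf P))"
    "s_gas ?S = (\<lambda>x. c_v P * ln (q / (q / (gas_const P * T_inf P)) powr gamma_exp P))"
    by (simp_all add: equilibrium_state_def Let_def q_def)
  have "liquid_eqs P (\<lambda>t. ?S) t" for t
    unfolding liquid_eqs_def Let_def equilibrium_state_stress S
    by (simp add: time_deriv_def outer_prod_zero)
  moreover have "gas_eqs P (\<lambda>t. ?S) t" for t
    unfolding gas_eqs_def Let_def equilibrium_state_stress S
    using pos by (simp add: time_deriv_def outer_prod_zero)
  moreover have "far_field P p_infty ?S"
    unfolding far_field_def S by simp
  ultimately show ?thesis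
    using equilibrium_state_geometry equilibrium_state_interface_eqs assms(3)
    by (auto simp: fs_equilibrium_def fs_solution_def)
qed

lemma symmetric_equilibrium_equilibrium_state:
  assumes "positive_params P" "p_infty > 0" "R > 0"
  shows "symmetric_equilibrium P p_infty R (equilibrium_state P p_infty R)"
proof
  let ?S = "equilibrium_state P p_infty R"
  show "fs_equilibrium P p_infty ?S" by (rule equilibrium_state_equilibrium[OF assms])
  show "regular_state ?S"
    by (simp add: equilibrium_state_def Let_def regular_state_def C1_on_const C2_on_const)
  show "spherically_symmetric ?S"
    using assms(3)
    by (auto simp: equilibrium_state_def Let_def spherically_symmetric_def radial_on_def radial_vec_on_def
        intro: exI[of _ "\<lambda>r. 0"])
  show "radiation_condition P ?S"
    by (simp add: equilibrium_state_def Let_def radiation_condition_def)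
  show "bubble ?S = ball 0 R" by (simp add: equilibrium_state_def Let_def)
qed (use assms in auto)

lemma symmetric_equilibriaD:
  assumes "positive_params P" "S \<in> symmetric_equilibria P p_infty M"
  obtains R where "symmetric_equilibrium P p_infty R S" "bubble_mass S = M"
proof -
  from assms(2) have S: "fs_equilibrium P p_infty S" "regular_state S" "spherically_symmetric S"
    "radiation_condition P S" "bubble_mass S = M" by (auto simp: symmetric_equilibria_def)
  then obtain R where "R > 0" "bubble S = ball 0 R" by (auto simp: spherically_symmetric_def)
  with S assms(1) that show ?thesis by (simp add: symmetric_equilibrium_def)
qed

theorem proposition4p1:
  fixes P :: bubble_params and p_infty :: real
  assumes "positive_params P" and "p_infty > 0"
  shows "\<exists>Rstar :: real \<Rightarrow> real.
    smooth_on_open {0<..} Rstar \<and>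
    (\<forall>M>0. Rstar M > 0 \<and>
      (\<exists>S \<in> symmetric_equilibria P p_infty M. bubble S = ball 0 (Rstar M)) \<and>
      (\<forall>S \<in> symmetric_equilibria P p_infty M.
         bubble S = ball 0 (Rstar M) \<and>
         (\<forall>x \<in> - bubble S.
            v_liq S x = 0 \<and>
            p_liq S x = p_infty \<and>
            T_liq S x = T_inf P) \<and>
         (\<forall>x \<in> closure (bubble S).
            rho_gas S x
              = 1 / (gas_const P * T_inf P) * (p_infty + 2 * surf_tension P / Rstar M) \<and>
            v_gas S x = 0 \<and>
            p_gas S x = p_infty + 2 * surf_tension P / Rstar M \<and>
            T_gas S x = T_inf P \<and>
            s_gas S x = c_v P * ln ((gas_const P * T_inf P) powr gamma_exp P
              * (p_infty + 2 * surf_tension P / Rstar M) powr (1 - gamma_exp P)))))"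
proof -
  \<comment> \<open>The coefficients of the mass as a cubic in the radius, taken from
    \<open>symmetric_equilibrium.mass\<close>.\<close>
  define a b where "a = 4 * pi / (3 * gas_const P * T_inf P) * p_infty"
    and "b = 4 * pi / (3 * gas_const P * T_inf P) * (2 * surf_tension P)"
  have "a > 0" "b > 0" using assms by (auto simp: a_def b_def positive_params_def)
  then obtain g where g: "smooth_on_open {0<..} g" "\<And>r. r > 0 \<Longrightarrow> g (a * r ^ 3 + b * r\<^sup>2) = r"
    "\<And>m. m > 0 \<Longrightarrow> g m > 0" "\<And>m. m > 0 \<Longrightarrow> a * g m ^ 3 + b * (g m)\<^sup>2 = m"
    by (rule cubic_inverse) blast
  have mass_cubic: "bubble_mass S = a * R ^ 3 + b * R\<^sup>2" if "symmetric_equilibrium P p_infty R S" for S R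
    using symmetric_equilibrium.mass[OF that] by (simp add: a_def b_def distrib_left mult.assoc)
  \<comment> \<open>The explicit state is itself a symmetric equilibrium of radius
    \<open>g M\<close>, so its mass comes from the general formula and equals \<open>M\<close>
    because \<open>g\<close> is a right inverse of the cubic.\<close>
  have ex: "\<exists>S \<in> symmetric_equilibria P p_infty M. bubble S = ball 0 (g M)" if "M > 0" for M
  proof -
    interpret symmetric_equilibrium P p_infty "g M" "equilibrium_state P p_infty (g M)"
      by (rule symmetric_equilibrium_equilibrium_state[OF assms g(3)[OF that]])
    have "bubble_mass (equilibrium_state P p_infty (g M)) = M"
      using mass_cubic[OF symmetric_equilibrium_axioms] g(4)[OF that] by simp
    then have "equilibrium_state P p_infty (g M) \<in> symmetric_equilibria P p_infty M"
      using equilibrium regular symmetric radiation by (simp add: symmetric_equilibria_def)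
    then show ?thesis using bubble by blast
  qed
  \<comment> \<open>The other half of invertibility: applying \<open>g\<close> to the mass of any
    equilibrium returns its radius.\<close>
  have radius: "symmetric_equilibrium P p_infty (g M) S" if S: "S \<in> symmetric_equilibria P p_infty M" for S M
  proof -
    obtain R where R: "symmetric_equilibrium P p_infty R S" "bubble_mass S = M"
      using symmetric_equilibriaD[OF assms(1) S] .
    have "g M = R" using mass_cubic[OF R(1)] R(2) g(2)[OF symmetric_equilibrium.R[OF R(1)]] by simp
    then show ?thesis using R(1) by simp
  qed
  note props = symmetric_equilibrium.bubble[OF radius]
    symmetric_equilibrium.liquid_at_rest[OF radius] symmetric_equilibrium.liquid_pressure[OF radius]
    symmetric_equilibrium.liquid_temperature[OF radius] symmetric_equilibrium.gas_density[OF radius]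
    symmetric_equilibrium.gas_at_rest[OF radius] symmetric_equilibrium.gas_pressure[OF radius]
    symmetric_equilibrium.gas_temperature[OF radius]
    symmetric_equilibrium.gas_entropy[OF radius assms(2)]
  show ?thesis
    by (intro exI[of _ g] conjI allI impI ballI g(1,3) ex props)
qed

end
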